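(* Let $\Omega\subset\mathbb{R}^{3}$ be a bounded domain with smooth boundary, $p>1$, $K\in L^{\infty}(\Omega)$ with $K\ge 0$, and $h\in L^{\infty}(\Omega)$ with $h>0$. Let $E=H^{1}_{0}(\Omega)\cap L^{p+1}(\Omega)$ and let $\mathcal{K}\subset E$ be a convex and weakly closed subset of $E$. Define $\psi(u)=\frac12\int_\Omega|\nabla u|^2dx$, $\psi_{\mathcal{K}}(u)=\psi(u)$ if $u\in\mathcal{K}$ and $\psi_{\mathcal{K}}(u)=+\infty$ otherwise, and $$\Phi(u)=-\frac14\int_\Omega K(x)\phi_u u^2dx+\frac1{p+1}\int_\Omega|u|^{p+1}dx+\int_\Omega h(x)u\,dx,\qquad I_{\mathcal{K}}=\psi_{\mathcal{K}}-\Phi.$$ Suppose that: (i) $I_{\mathcal{K}}$ has a critical point $u_1$, in the sense that $u_1\in\mathcal{K}$ and $\langle D\Phi(u_1),u_1-v\rangle+\psi_{\mathcal{K}}(v)-\psi_{\mathcal{K}}(u_1)\ge 0$ for all $v\in E$, where $\langle D\Phi(u_1),w\rangle=\int_\Omega\big(-K\phi_{u_1}u_1+|u_1|^{p-1}u_1+h\big)w\,dx$; and (ii) there exists $u_2\in\mathcal{K}$ such that $$\int_\Omega\nabla u_2\cdot\nabla\varphi\,dx=-\int_\Omega K(x)\phi_{u_1}u_1\varphi\,dx+\int_\Omega|u_1|^{p-1}u_1\varphi\,dx+\int_\Omega h(x)\varphi\,dx\quad\text{for all }\varphi\in E.$$ Then $u_1\in\mathcal{K}$ is a weak solution of the system $-\Delta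 u+K(x)\phi u=|u|^{p-1}u+h$ in $\Omega$, $-\Delta\phi=K(x)u^2$ in $\Omega$, $\phi=u=0$ on $\partial\Omega$ (with $\phi=\phi_{u_1}$).
   Context: For $u\in E$, $\phi_u\in H^1_0(\Omega)$ denotes the unique weak solution of $-\Delta\phi_u=K(x)u^2$ in $\Omega$ with zero boundary values. A weak solution means $u\in E$ with $\int_\Omega\nabla u\cdot\nabla\varphi+\int_\Omega K\phi_u u\varphi=\int_\Omega|u|^{p-1}u\varphi+\int_\Omega h\varphi$ for all $\varphi\in E$. (The paper denotes the convex set by $K$, the same letter as the coefficient; here it is renamed $\mathcal{K}$.) *)

theory Defs
  imports "HOL-Analysis.Analysis"
begin

type_synonym R3 = "real^3"

fun Ck_on :: "nat \<Rightarrow> R3 set \<Rightarrow> (R3 \<Rightarrow> real) \<Rightarrow> bool" where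
  "Ck_on 0 S f = continuous_on S f"
| "Ck_on (Suc k) S f =
     (f differentiable_on S \<and>
      (\<forall>i::3. Ck_on k S (\<lambda>x. frechet_derivative f (at x) (axis i 1))))"

definition smooth_on :: "R3 set \<Rightarrow> (R3 \<Rightarrow> real) \<Rightarrow> bool" where
  "smooth_on S f \<longleftrightarrow> (\<forall>k. Ck_on k S f)"

definition pd :: "3 \<Rightarrow> (R3 \<Rightarrow> real) \<Rightarrow> R3 \<Rightarrow> real" where
  "pd i f x = frechet_derivative f (at x) (axis i 1)"

definition smooth_boundary :: "R3 set \<Rightarrow> bool" where
  "smooth_boundary \<Omega> \<longleftrightarrow>
     (\<forall>x\<in>frontier \<Omega>. \<exists>r>0. \<exists>g. smooth_on (ball x r) g \<and>
         (\<forall>y\<in>ball x r. frechet_derivative g (at y) \<noteq> (\<lambda>_. 0)) \<and>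
         \<Omega> \<inter> ball x r = {y\<in>ball x r. g y < 0})"

definition smooth_bounded_domain :: "R3 set \<Rightarrow> bool" where
  "smooth_bounded_domain \<Omega> \<longleftrightarrow>
     open \<Omega> \<and> connected \<Omega> \<and> \<Omega> \<noteq> {} \<and> bounded \<Omega> \<and> smooth_boundary \<Omega>"

definition test_fun :: "R3 set \<Rightarrow> (R3 \<Rightarrow> real) \<Rightarrow> bool" where
  "test_fun \<Omega> f \<longleftrightarrow> smooth_on UNIV f \<and>
     compact (closure {x. f x \<noteq> 0}) \<and> closure {x. f x \<noteq> 0} \<subseteq> \<Omega>"

definition Lp :: "R3 set \<Rightarrow> real \<Rightarrow> (R3 \<Rightarrow> real) \<Rightarrow> bool" where
  "Lp \<Omega> q u \<longleftrightarrow> u \<in> borel_measurable (lebesgue_on \<Omega>) \<and>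
     integrable (lebesgue_on \<Omega>) (\<lambda>x. \<bar>u x\<bar> powr q)"

definition Lnorm :: "R3 set \<Rightarrow> real \<Rightarrow> (R3 \<Rightarrow> real) \<Rightarrow> real" where
  "Lnorm \<Omega> q u = (LINT x|lebesgue_on \<Omega>. \<bar>u x\<bar> powr q) powr (1 / q)"

definition Linf :: "R3 set \<Rightarrow> (R3 \<Rightarrow> real) \<Rightarrow> bool" where
  "Linf \<Omega> u \<longleftrightarrow> u \<in> borel_measurable (lebesgue_on \<Omega>) \<and>
     (\<exists>C. AE x in lebesgue_on \<Omega>. \<bar>u x\<bar> \<le> C)"

definition loc_integrable :: "R3 set \<Rightarrow> (R3 \<Rightarrow> real) \<Rightarrow> bool" where
  "loc_integrable \<Omega> u \<longleftrightarrow>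
     (\<forall>C. compact C \<and> C \<subseteq> \<Omega> \<longrightarrow> integrable (lebesgue_on C) u)"

definition weak_grad :: "R3 set \<Rightarrow> (R3 \<Rightarrow> real) \<Rightarrow> (R3 \<Rightarrow> R3) \<Rightarrow> bool" where
  "weak_grad \<Omega> u G \<longleftrightarrow> loc_integrable \<Omega> u \<and>
     (\<forall>i. loc_integrable \<Omega> (\<lambda>x. G x $ i)) \<and>
     (\<forall>i f. test_fun \<Omega> f \<longrightarrow>
        (LINT x|lebesgue_on \<Omega>. u x * pd i f x) = - (LINT x|lebesgue_on \<Omega>. G x $ i * f x))"

definition H1 :: "R3 set \<Rightarrow> (R3 \<Rightarrow> real) \<Rightarrow> bool" where
  "H1 \<Omega> u \<longleftrightarrow> Lp \<Omega> 2 u \<and>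
     (\<exists>G. weak_grad \<Omega> u G \<and> (\<forall>i. Lp \<Omega> 2 (\<lambda>x. G x $ i)))"

text \<open>The weak gradient (a representative; unique a.e.).\<close>
definition wgrad :: "R3 set \<Rightarrow> (R3 \<Rightarrow> real) \<Rightarrow> R3 \<Rightarrow> R3" where
  "wgrad \<Omega> u = (SOME G. weak_grad \<Omega> u G \<and> (\<forall>i. Lp \<Omega> 2 (\<lambda>x. G x $ i)))"

definition H1norm :: "R3 set \<Rightarrow> (R3 \<Rightarrow> real) \<Rightarrow> real" where
  "H1norm \<Omega> u = Lnorm \<Omega> 2 u + Lnorm \<Omega> 2 (\<lambda>x. norm (wgrad \<Omega> u x))"

definition H10 :: "R3 set \<Rightarrow> (R3 \<Rightarrow> real) \<Rightarrow> bool" where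
  "H10 \<Omega> u \<longleftrightarrow> H1 \<Omega> u \<and>
     (\<exists>f. (\<forall>n. test_fun \<Omega> (f n)) \<and>
          (\<lambda>n. H1norm \<Omega> (\<lambda>x. f n x - u x)) \<longlonglongrightarrow> 0)"

definition Espace :: "R3 set \<Rightarrow> real \<Rightarrow> (R3 \<Rightarrow> real) set" where
  "Espace \<Omega> p = {u. H10 \<Omega> u \<and> Lp \<Omega> (p + 1) u}"

definition Enorm :: "R3 set \<Rightarrow> real \<Rightarrow> (R3 \<Rightarrow> real) \<Rightarrow> real" where
  "Enorm \<Omega> p u = H1norm \<Omega> u + Lnorm \<Omega> (p + 1) u"

definition E_dual :: "R3 set \<Rightarrow> real \<Rightarrow> ((R3 \<Rightarrow> real) \<Rightarrow> real) set" where
  "E_dual \<Omega> p = {l. (\<forall>u\<in>Espace \<Omega> p. \<forall>v\<in>Espace \<Omega> p. \<forall>a b::real.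
                        l (\<lambda>x. a * u x + b * v x) = a * l u + b * l v) \<and>
                    (\<exists>C. \<forall>u\<in>Espace \<Omega> p. \<bar>l u\<bar> \<le> C * Enorm \<Omega> p u)}"

text \<open>Weakly closed subset of E: its complement in E is open in the weak topology
  sigma(E,E*), i.e. every point of the complement has a basic weak neighbourhood
  disjoint from the set.\<close>
definition weakly_closed_in_E :: "R3 set \<Rightarrow> real \<Rightarrow> (R3 \<Rightarrow> real) set \<Rightarrow> bool" where
  "weakly_closed_in_E \<Omega> p S \<longleftrightarrow> S \<subseteq> Espace \<Omega> p \<and>
     (\<forall>u\<in>Espace \<Omega> p - S. \<exists>L. finite L \<and> L \<subseteq> E_dual \<Omega> p \<and> (\<exists>\<epsilon>>0.
        \<forall>v\<in>Espace \<Omega> p. (\<forall>l\<in>L. \<bar>l v - l u\<bar> < \<epsilon>) \<longrightarrow> v \<notin> S))"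

definition convex_fun_set :: "(R3 \<Rightarrow> real) set \<Rightarrow> bool" where
  "convex_fun_set S \<longleftrightarrow>
     (\<forall>u\<in>S. \<forall>v\<in>S. \<forall>t::real. 0 \<le> t \<and> t \<le> 1 \<longrightarrow> (\<lambda>x. (1 - t) * u x + t * v x) \<in> S)"

definition phi_of :: "R3 set \<Rightarrow> (R3 \<Rightarrow> real) \<Rightarrow> (R3 \<Rightarrow> real) \<Rightarrow> R3 \<Rightarrow> real" where
  "phi_of \<Omega> K u = (SOME \<phi>. H10 \<Omega> \<phi> \<and>
      (\<forall>w. H10 \<Omega> w \<longrightarrow>
         (LINT x|lebesgue_on \<Omega>. wgrad \<Omega> \<phi> x \<bullet> wgrad \<Omega> w x)
         = (LINT x|lebesgue_on \<Omega>. K x * (u x)\<^sup>2 * w x)))"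

definition psi :: "R3 set \<Rightarrow> (R3 \<Rightarrow> real) \<Rightarrow> real" where
  "psi \<Omega> u = 1/2 * (LINT x|lebesgue_on \<Omega>. (norm (wgrad \<Omega> u x))\<^sup>2)"

definition psiK :: "R3 set \<Rightarrow> (R3 \<Rightarrow> real) set \<Rightarrow> (R3 \<Rightarrow> real) \<Rightarrow> ereal" where
  "psiK \<Omega> \<K> u = (if u \<in> \<K> then ereal (psi \<Omega> u) else \<infinity>)"

definition Phi :: "R3 set \<Rightarrow> real \<Rightarrow> (R3 \<Rightarrow> real) \<Rightarrow> (R3 \<Rightarrow> real) \<Rightarrow> (R3 \<Rightarrow> real) \<Rightarrow> real" where
  "Phi \<Omega> p K h u =
     - 1/4 * (LINT x|lebesgue_on \<Omega>. K x * phi_of \<Omega> K u x * (u x)\<^sup>2)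
     + 1/(p+1) * (LINT x|lebesgue_on \<Omega>. \<bar>u x\<bar> powr (p+1))
     + (LINT x|lebesgue_on \<Omega>. h x * u x)"

definition DPhi :: "R3 set \<Rightarrow> real \<Rightarrow> (R3 \<Rightarrow> real) \<Rightarrow> (R3 \<Rightarrow> real) \<Rightarrow> (R3 \<Rightarrow> real)
                    \<Rightarrow> (R3 \<Rightarrow> real) \<Rightarrow> real" where
  "DPhi \<Omega> p K h u w = (LINT x|lebesgue_on \<Omega>.
      (- K x * phi_of \<Omega> K u x * u x + \<bar>u x\<bar> powr (p - 1) * u x + h x) * w x)"

text \<open>Critical point of I_K = psi_K - Phi (Szulkin's sense).\<close>
definition critical_point_IK ::
  "R3 set \<Rightarrow> real \<Rightarrow> (R3 \<Rightarrow> real) \<Rightarrow> (R3 \<Rightarrow> real) \<Rightarrow> (R3 \<Rightarrow> real) set \<Rightarrow> (R3 \<Rightarrow> real) \<Rightarrow> bool" where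
  "critical_point_IK \<Omega> p K h \<K> u \<longleftrightarrow> u \<in> \<K> \<and>
     (\<forall>v\<in>Espace \<Omega> p.
        ereal (DPhi \<Omega> p K h u (\<lambda>x. u x - v x)) + psiK \<Omega> \<K> v - psiK \<Omega> \<K> u \<ge> 0)"

definition weak_solution ::
  "R3 set \<Rightarrow> real \<Rightarrow> (R3 \<Rightarrow> real) \<Rightarrow> (R3 \<Rightarrow> real) \<Rightarrow> (R3 \<Rightarrow> real) \<Rightarrow> bool" where
  "weak_solution \<Omega> p K h u \<longleftrightarrow> u \<in> Espace \<Omega> p \<and>
     (\<forall>w\<in>Espace \<Omega> p.
        (LINT x|lebesgue_on \<Omega>. wgrad \<Omega> u x \<bullet> wgrad \<Omega> w x)
        + (LINT x|lebesgue_on \<Omega>. K x * phi_of \<Omega> K u x * u x * w x)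
        = (LINT x|lebesgue_on \<Omega>. \<bar>u x\<bar> powr (p - 1) * u x * w x)
        + (LINT x|lebesgue_on \<Omega>. h x * w x))"

end

theory Submission
  imports Defs
begin

text \<open>Testing (i) with \<open>v = u\<^sub>2\<close> and (ii) with \<open>\<phi> = u\<^sub>1 - u\<^sub>2\<close> gives
  \<open>\<integral>\<nabla>u\<^sub>2\<cdot>\<nabla>(u\<^sub>1 - u\<^sub>2) + 1/2 \<integral>|\<nabla>u\<^sub>2|\<^sup>2 - 1/2 \<integral>|\<nabla>u\<^sub>1|\<^sup>2 \<ge> 0\<close>, that is
  \<open>\<integral>|\<nabla>u\<^sub>1 - \<nabla>u\<^sub>2|\<^sup>2 \<le> 0\<close>. Hence \<open>\<nabla>u\<^sub>1 = \<nabla>u\<^sub>2\<close> almost everywhere, and (ii) is the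
  weak equation for \<open>u\<^sub>1\<close>.

  This needs \<open>D\<Phi>(u\<^sub>1)\<close> to split into three convergent integrals. The delicate term
  \<open>K \<phi> u w\<close> is controlled by \<open>\<integral>|f g h| \<le> C \<parallel>\<nabla>f\<parallel> \<parallel>\<nabla>g\<parallel> \<parallel>\<nabla>h\<parallel>\<close> on \<open>H\<^sub>0\<^sup>1\<close>, obtained from
  the Loomis-Whitney inequality applied to \<open>f\<^sup>2 \<le> \<integral>|2 f \<partial>\<^sub>i f| dx\<^sub>i\<close>, one coordinate
  direction per factor, and from the Poincare inequality. The same bound makes
  \<open>w \<mapsto> \<integral>K u\<^sup>2 w\<close> continuous, so that \<open>\<phi>\<^sub>u\<close> exists and the choice operator defining it
  is not junk. Weak gradients, also defined by choice, are linear only up to null sets,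
  which rests on the fundamental lemma of the calculus of variations.\<close>

section \<open>Square-integrable functions\<close>

text \<open>Every integral here is a Bochner integral, equal to 0 when the integrand is not
  integrable, so splitting D\<Phi> can genuinely fail unless each summand is integrable. The term
  \<open>K \<phi> u w\<close> is a bounded function times three functions from \<open>H10\<close>;
  control of triple products, in effect an embedding into L3, suffices, and the sharp Sobolev
  exponent can be avoided. Functions are not identified when equal almost everywhere, so the norms
  are only seminorms, and the choice operators \<open>wgrad\<close> and \<open>phi_of\<close> stand
  in the statement itself. The proof keeps them at a distance: estimates are shown for test
  functions, whose gradients are classical, and pass by L2 limits to pairs \<open>(u, G)\<close> in
  the closure of the graph of the gradient; only then is \<open>G\<close> compared with
  \<open>wgrad\<close>. In the same spirit \<open>\<phi>\<^sub>u\<close> comes from a direct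
  minimisation over test functions.\<close>

definition L2 :: "'a measure \<Rightarrow> ('a \<Rightarrow> 'b::euclidean_space) \<Rightarrow> bool" where
  "L2 M f \<longleftrightarrow> f \<in> borel_measurable M \<and> integrable M (\<lambda>x. (norm (f x))\<^sup>2)"

definition L2norm :: "'a measure \<Rightarrow> ('a \<Rightarrow> 'b::euclidean_space) \<Rightarrow> real" where
  "L2norm M f = sqrt (LINT x|M. (norm (f x))\<^sup>2)"

lemma L2_measurable: "L2 M f \<Longrightarrow> f \<in> borel_measurable M"
  by (simp add: L2_def)

lemma L2_norm_sq_integrable: "L2 M f \<Longrightarrow> integrable M (\<lambda>x. (norm (f x))\<^sup>2)"
  by (simp add: L2_def)

lemma L2norm_nonneg: "L2norm M f \<ge> 0"
  by (simp add: L2norm_def)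

lemma L2norm_sq: "(L2norm M f)\<^sup>2 = (LINT x|M. (norm (f x))\<^sup>2)"
  by (simp add: L2norm_def)

lemma L2_norm_mult_integrable:
  fixes f :: "'a \<Rightarrow> 'b::euclidean_space" and g :: "'a \<Rightarrow> 'c::euclidean_space"
  assumes "L2 M f" "L2 M g"
  shows "integrable M (\<lambda>x. norm (f x) * norm (g x))"
proof (rule Bochner_Integration.integrable_bound)
  show "integrable M (\<lambda>x. (norm (f x))\<^sup>2 + (norm (g x))\<^sup>2)"
    using assms by (simp add: L2_def)
  show "(\<lambda>x. norm (f x) * norm (g x)) \<in> borel_measurable M"
    using assms[THEN L2_measurable] by measurable
  have "norm (norm (f x) * norm (g x)) \<le> norm ((norm (f x))\<^sup>2 + (norm (g x))\<^sup>2)" for x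
    using sum_squares_bound[of "norm (f x)" "norm (g x)"] mult_nonneg_nonneg[of "norm (f x)" "norm (g x)"]
    by (simp del: mult_nonneg_nonneg)
  then show "AE x in M. norm (norm (f x) * norm (g x)) \<le> norm ((norm (f x))\<^sup>2 + (norm (g x))\<^sup>2)"
    by simp
qed

lemma L2_inner_integrable:
  assumes "L2 M f" "L2 M g"
  shows "integrable M (\<lambda>x. f x \<bullet> g x)"
proof (rule Bochner_Integration.integrable_bound[OF L2_norm_mult_integrable[OF assms]])
  show "(\<lambda>x. f x \<bullet> g x) \<in> borel_measurable M"
    using assms[THEN L2_measurable] by measurable
  show "AE x in M. norm (f x \<bullet> g x) \<le> norm (norm (f x) * norm (g x))"
    by (simp add: Cauchy_Schwarz_ineq2)
qed

lemma norm_sq_lin_le: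
  fixes u v :: "'b::real_normed_vector"
  shows "(norm (a *\<^sub>R u + b *\<^sub>R v))\<^sup>2 \<le> 2 * a\<^sup>2 * (norm u)\<^sup>2 + 2 * b\<^sup>2 * (norm v)\<^sup>2"
proof -
  have "norm (a *\<^sub>R u + b *\<^sub>R v) \<le> \<bar>a\<bar> * norm u + \<bar>b\<bar> * norm v"
    by (metis norm_scaleR norm_triangle_ineq)
  then have "(norm (a *\<^sub>R u + b *\<^sub>R v))\<^sup>2 \<le> (\<bar>a\<bar> * norm u + \<bar>b\<bar> * norm v)\<^sup>2"
    by (simp add: power_mono)
  also have "\<dots> \<le> 2 * a\<^sup>2 * (norm u)\<^sup>2 + 2 * b\<^sup>2 * (norm v)\<^sup>2"
    using sum_squares_bound[of "\<bar>a\<bar> * norm u" "\<bar>b\<bar> * norm v"]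
    by (simp add: power2_sum power_mult_distrib)
  finally show ?thesis .
qed

lemma L2_lin:
  assumes "L2 M f" "L2 M g"
  shows "L2 M (\<lambda>x. a *\<^sub>R f x + b *\<^sub>R g x)"
  unfolding L2_def
proof
  show m: "(\<lambda>x. a *\<^sub>R f x + b *\<^sub>R g x) \<in> borel_measurable M"
    using assms[THEN L2_measurable] by measurable
  show "integrable M (\<lambda>x. (norm (a *\<^sub>R f x + b *\<^sub>R g x))\<^sup>2)"
  proof (rule Bochner_Integration.integrable_bound)
    show "integrable M (\<lambda>x. 2 * a\<^sup>2 * (norm (f x))\<^sup>2 + 2 * b\<^sup>2 * (norm (g x))\<^sup>2)"
      using assms by (simp add: L2_def)
    show "(\<lambda>x. (norm (a *\<^sub>R f x + b *\<^sub>R g x))\<^sup>2) \<in> borel_measurable M"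
      using m by measurable
  qed (use norm_sq_lin_le in \<open>fastforce intro: order_trans\<close>)
qed

lemma L2_diff: "L2 M f \<Longrightarrow> L2 M g \<Longrightarrow> L2 M (\<lambda>x. f x - g x)"
  using L2_lin[of M f g 1 "-1"] by simp

lemma L2_scale: "L2 M f \<Longrightarrow> L2 M (\<lambda>x. a *\<^sub>R f x)"
  using L2_lin[of M f f a 0] by simp

lemma L2norm_eq_0_AE:
  assumes "L2 M f" "L2norm M f = 0"
  shows "AE x in M. f x = 0"
proof -
  have "(LINT x|M. (norm (f x))\<^sup>2) = 0"
    using assms(2) by (simp add: L2norm_def)
  then have "AE x in M. (norm (f x))\<^sup>2 = 0"
    using integral_nonneg_eq_0_iff_AE[OF L2_norm_sq_integrable[OF assms(1)]] by simp
  then show ?thesis by simp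
qed

lemma L2norm_cong_AE:
  assumes "f \<in> borel_measurable M" "g \<in> borel_measurable M" "AE x in M. f x = g x"
  shows "L2norm M f = L2norm M g"
  unfolding L2norm_def using assms
  by (intro arg_cong[of _ _ sqrt] integral_cong_AE) auto

lemma L2norm_sq_lin:
  assumes "L2 M f" "L2 M g"
  shows "(L2norm M (\<lambda>x. a *\<^sub>R f x + b *\<^sub>R g x))\<^sup>2
       = a\<^sup>2 * (L2norm M f)\<^sup>2 + 2 * a * b * (LINT x|M. f x \<bullet> g x) + b\<^sup>2 * (L2norm M g)\<^sup>2"
proof -
  have e: "(norm (a *\<^sub>R f x + b *\<^sub>R g x))\<^sup>2
       = a\<^sup>2 * (norm (f x))\<^sup>2 + 2 * a * b * (f x \<bullet> g x) + b\<^sup>2 * (norm (g x))\<^sup>2" for x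
    unfolding power2_norm_eq_inner
    by (simp add: inner_add_left inner_add_right inner_commute power2_eq_square algebra_simps)
  show ?thesis
    unfolding L2norm_sq e
    using L2_norm_sq_integrable[OF assms(1)] L2_norm_sq_integrable[OF assms(2)] L2_inner_integrable[OF assms]
    by simp
qed

text \<open>The quadratic form \<open>s\<^sup>2 * a + 2 * s * t * b + t\<^sup>2 * c\<close> is the
  squared norm of \<open>s f + t g\<close>, hence never negative, so its discriminant is not
  positive.\<close>

lemma L2_Cauchy_Schwarz:
  assumes "L2 M f" "L2 M g"
  shows "\<bar>LINT x|M. f x \<bullet> g x\<bar> \<le> L2norm M f * L2norm M g"
proof -
  define a b c where "a = (L2norm M f)\<^sup>2" and "b = (LINT x|M. f x \<bullet> g x)" and "c = (L2norm M g)\<^sup>2"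
  have q: "0 \<le> s\<^sup>2 * a + 2 * s * t * b + t\<^sup>2 * c" for s t
    using L2norm_sq_lin[OF assms, of s t] unfolding a_def b_def c_def by (metis zero_le_power2)
  have "b\<^sup>2 \<le> a * c"
  proof (cases "c = 0")
    case True
    \<comment> \<open>For \<open>c = 0\<close> and \<open>s = 1\<close> the form is affine in
      \<open>t\<close>; if \<open>b\<close> were nonzero, the chosen \<open>t\<close> would give it
      the value -1.\<close>
    have "b = 0"
      using q[of 1 "- (a + 1) / (2 * b)"] True by (cases "b = 0") (auto simp: field_simps)
    then show ?thesis using True by simp
  next
    case False
    then have "c > 0" by (simp add: c_def)
    \<comment> \<open>This is the form at \<open>s = c\<close>, \<open>t = -b\<close>.\<close>
    moreover have "0 \<le> c * (a * c - b\<^sup>2)"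
      using q[of c "-b"] by (simp add: algebra_simps power2_eq_square)
    ultimately show ?thesis
      by (simp add: zero_le_mult_iff)
  qed
  then have "\<bar>b\<bar>\<^sup>2 \<le> (L2norm M f * L2norm M g)\<^sup>2"
    by (simp add: a_def c_def power_mult_distrib)
  then show ?thesis
    unfolding b_def by (rule power2_le_imp_le) (simp add: L2norm_nonneg)
qed

lemma L2norm_triangle:
  assumes "L2 M f" "L2 M g"
  shows "L2norm M (\<lambda>x. f x + g x) \<le> L2norm M f + L2norm M g"
proof (rule power2_le_imp_le)
  have "(L2norm M (\<lambda>x. f x + g x))\<^sup>2
      = (L2norm M f)\<^sup>2 + 2 * (LINT x|M. f x \<bullet> g x) + (L2norm M g)\<^sup>2"
    using L2norm_sq_lin[OF assms, of 1 1] by simp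
  also have "\<dots> \<le> (L2norm M f + L2norm M g)\<^sup>2"
    using L2_Cauchy_Schwarz[OF assms] by (simp add: power2_sum)
  finally show "(L2norm M (\<lambda>x. f x + g x))\<^sup>2 \<le> (L2norm M f + L2norm M g)\<^sup>2" .
qed (simp add: L2norm_nonneg)

lemma L2norm_scale: "L2norm M (\<lambda>x. a *\<^sub>R f x) = \<bar>a\<bar> * L2norm M f"
  by (simp add: L2norm_def power_mult_distrib real_sqrt_mult)

lemma L2norm_minus_commute:
  "L2norm M (\<lambda>x. f x - g x) = L2norm M (\<lambda>x. g x - f x)"
  by (simp add: L2norm_def norm_minus_commute)

section \<open>Limits, almost everywhere convergent subsequences and completeness in L2\<close>

lemma L2norm_tendsto:
  assumes "\<And>n. L2 M (f n)" "L2 M g" "(\<lambda>n. L2norm M (\<lambda>x. f n x - g x)) \<longlonglongrightarrow> 0"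
  shows "(\<lambda>n. L2norm M (f n)) \<longlonglongrightarrow> L2norm M g"
proof (rule LIM_zero_cancel, rule tendsto_0_le[OF assms(3), of _ 1], rule always_eventually, rule allI)
  fix n
  have "L2norm M (f n) \<le> L2norm M (\<lambda>x. f n x - g x) + L2norm M g"
    using L2norm_triangle[OF L2_diff[OF assms(1,2)] assms(2), of n] by simp
  moreover have "L2norm M g \<le> L2norm M (\<lambda>x. f n x - g x) + L2norm M (f n)"
    using L2norm_triangle[OF L2_diff[OF assms(2) assms(1)] assms(1), of n n]
    by (simp add: L2norm_minus_commute[of M g])
  ultimately show "norm (L2norm M (f n) - L2norm M g) \<le> norm (L2norm M (\<lambda>x. f n x - g x)) * 1"
    by (simp add: L2norm_nonneg abs_le_iff)
qed

lemma L2_inner_tendsto: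
  assumes "\<And>n. L2 M (f n)" "L2 M g" "L2 M h" "(\<lambda>n. L2norm M (\<lambda>x. f n x - g x)) \<longlonglongrightarrow> 0"
  shows "(\<lambda>n. LINT x|M. f n x \<bullet> h x) \<longlonglongrightarrow> (LINT x|M. g x \<bullet> h x)"
proof (rule LIM_zero_cancel, rule tendsto_0_le[OF assms(4), of _ "L2norm M h"], rule always_eventually, rule allI)
  fix n
  have "(LINT x|M. f n x \<bullet> h x) - (LINT x|M. g x \<bullet> h x) = (LINT x|M. (f n x - g x) \<bullet> h x)"
    using assms by (simp add: inner_diff_left L2_inner_integrable)
  then show "norm ((LINT x|M. f n x \<bullet> h x) - (LINT x|M. g x \<bullet> h x))
      \<le> norm (L2norm M (\<lambda>x. f n x - g x)) * L2norm M h"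
    using L2_Cauchy_Schwarz[OF L2_diff[OF assms(1,2)] assms(3), of n] by (simp add: L2norm_nonneg)
qed

lemma L2norm_lin_tendsto_0:
  assumes "\<And>n. L2 M (f n)" "\<And>n. L2 M (g n)"
    and "(\<lambda>n. L2norm M (f n)) \<longlonglongrightarrow> 0" "(\<lambda>n. L2norm M (g n)) \<longlonglongrightarrow> 0"
  shows "(\<lambda>n. L2norm M (\<lambda>x. a *\<^sub>R f n x + b *\<^sub>R g n x)) \<longlonglongrightarrow> 0"
proof (rule tendsto_sandwich[where f = "\<lambda>_. 0"])
  have "(\<lambda>n. \<bar>a\<bar> * L2norm M (f n) + \<bar>b\<bar> * L2norm M (g n)) \<longlonglongrightarrow> \<bar>a\<bar> * 0 + \<bar>b\<bar> * 0"
    by (intro tendsto_intros assms)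
  then show "(\<lambda>n. \<bar>a\<bar> * L2norm M (f n) + \<bar>b\<bar> * L2norm M (g n)) \<longlonglongrightarrow> 0"
    by simp
  show "\<forall>\<^sub>F n in sequentially. L2norm M (\<lambda>x. a *\<^sub>R f n x + b *\<^sub>R g n x)
      \<le> \<bar>a\<bar> * L2norm M (f n) + \<bar>b\<bar> * L2norm M (g n)"
    using L2norm_triangle[OF L2_scale[OF assms(1)] L2_scale[OF assms(2)]] by (simp add: L2norm_scale)
qed (simp_all add: L2norm_nonneg)

text \<open>The squared errors tend to 0 in L1, where such a subsequence is known to exist.
  Pointwise limits are needed for Fatou's lemma in the trilinear estimate.\<close>

lemma L2_AE_subseq:
  assumes "\<And>n. L2 M (f n)" "L2 M g" "(\<lambda>n. L2norm M (\<lambda>x. f n x - g x)) \<longlonglongrightarrow> 0"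
  obtains r where "strict_mono r" "AE x in M. (\<lambda>n. f (r n) x) \<longlonglongrightarrow> g x"
proof -
  have i: "integrable M (\<lambda>x. (norm (f n x - g x))\<^sup>2)" for n
    by (intro L2_norm_sq_integrable L2_diff assms)
  have "(\<lambda>n. LINT x|M. norm ((norm (f n x - g x))\<^sup>2)) \<longlonglongrightarrow> 0"
    using tendsto_power[OF assms(3), of 2] by (simp add: L2norm_sq)
  from tendsto_L1_AE_subseq[OF i this] obtain r where r: "strict_mono r"
    "AE x in M. (\<lambda>n. (norm (f (r n) x - g x))\<^sup>2) \<longlonglongrightarrow> 0" by blast
  have "AE x in M. (\<lambda>n. f (r n) x) \<longlonglongrightarrow> g x"
    using r(2)
  proof eventually_elim
    case (elim x)
    then have "(\<lambda>n. sqrt ((norm (f (r n) x - g x))\<^sup>2)) \<longlonglongrightarrow> sqrt 0"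
      by (rule tendsto_real_sqrt)
    then show ?case by (simp add: tendsto_norm_zero_iff LIM_zero_iff)
  qed
  with r(1) show ?thesis by (rule that)
qed

lemma L2norm_mono:
  assumes "L2 M g" "f \<in> borel_measurable M" "\<And>x. norm (f x) \<le> norm (g x)"
  shows "L2 M f" "L2norm M f \<le> L2norm M g"
proof -
  have le: "(norm (f x))\<^sup>2 \<le> (norm (g x))\<^sup>2" for x
    using assms(3) by (simp add: power_mono)
  show f: "L2 M f"
    unfolding L2_def
  proof (intro conjI assms(2) Bochner_Integration.integrable_bound[OF L2_norm_sq_integrable[OF assms(1)]])
    show "(\<lambda>x. (norm (f x))\<^sup>2) \<in> borel_measurable M"
      using assms(2) by measurable
  qed (use le in simp)
  show "L2norm M f \<le> L2norm M g"
    unfolding L2norm_def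
    by (intro real_sqrt_le_mono integral_mono L2_norm_sq_integrable f assms le)
qed

lemma L2norm_nth_le:
  fixes G :: "'a \<Rightarrow> R3"
  assumes "L2 M G"
  shows "L2 M (\<lambda>x. G x $ i)" "L2norm M (\<lambda>x. G x $ i) \<le> L2norm M G"
proof -
  have "(\<lambda>x. G x $ i) \<in> borel_measurable M"
    using L2_measurable[OF assms] by (intro borel_measurable_continuous_on[of "\<lambda>v. v $ i"] continuous_intros)
  then show "L2 M (\<lambda>x. G x $ i)" "L2norm M (\<lambda>x. G x $ i) \<le> L2norm M G"
    using L2norm_mono[OF assms, of "\<lambda>x. G x $ i"] component_le_norm_cart by (auto simp: real_norm_def)
qed

lemma L2norm_norm: "L2norm M (\<lambda>x. norm (G x)) = L2norm M G"
  by (simp add: L2norm_def)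

lemma (in finite_measure) L2_integrable:
  fixes f :: "'a \<Rightarrow> 'b::euclidean_space"
  assumes "L2 M f" shows "integrable M f"
proof (rule Bochner_Integration.integrable_bound)
  show "integrable M (\<lambda>x. 1 + (norm (f x))\<^sup>2)" using assms by (simp add: L2_def)
  show "f \<in> borel_measurable M" using assms by (rule L2_measurable)
  have "norm (f x) \<le> norm (1 + (norm (f x))\<^sup>2)" for x
    using sum_squares_bound[of 1 "norm (f x)"] norm_ge_zero[of "f x"] by (simp del: norm_ge_zero)
  then show "AE x in M. norm (f x) \<le> norm (1 + (norm (f x))\<^sup>2)" by simp
qed

lemma (in finite_measure) L2_bounded:
  assumes "f \<in> borel_measurable M" "AE x in M. norm (f x) \<le> B"
  shows "L2 M f"
  unfolding L2_def
proof (intro conjI assms integrable_const_bound[where B = "B\<^sup>2"])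
  show "AE x in M. norm ((norm (f x))\<^sup>2) \<le> B\<^sup>2"
    using assms(2) by eventually_elim (simp add: power_mono)
qed (use assms(1) in measurable)

lemma (in finite_measure) L1_le_L2norm:
  fixes f :: "'a \<Rightarrow> 'b::euclidean_space"
  assumes "L2 M f"
  shows "(LINT x|M. norm (f x)) \<le> sqrt (measure M (space M)) * L2norm M f"
proof -
  have 1: "L2 M (\<lambda>x. norm (f x))" using assms by (auto simp: L2_def)
  have 2: "L2 M (\<lambda>x. 1::real)" by (rule L2_bounded) auto
  have "\<bar>LINT x|M. 1 \<bullet> norm (f x)\<bar> \<le> L2norm M (\<lambda>x. 1::real) * L2norm M (\<lambda>x. norm (f x))"
    by (rule L2_Cauchy_Schwarz[OF 2 1])
  then show ?thesis by (simp add: L2norm_def)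
qed

text \<open>Riesz-Fischer. A subsequence with increments of norm below \<open>(1/2)^k\<close>
  converges almost everywhere, because on a finite measure space these increments are also summable
  in L1. Fatou's lemma then turns the Cauchy condition into norm convergence of the whole
  sequence.\<close>

lemma (in finite_measure) L2_complete:
  fixes f :: "nat \<Rightarrow> 'a \<Rightarrow> 'b::euclidean_space"
  assumes L: "\<And>n. L2 M (f n)"
    and C: "\<And>e. e > 0 \<Longrightarrow> \<exists>N. \<forall>m\<ge>N. \<forall>n\<ge>N. L2norm M (\<lambda>x. f m x - f n x) < e"
  obtains g where "L2 M g" "(\<lambda>n. L2norm M (\<lambda>x. f n x - g x)) \<longlonglongrightarrow> 0"
proof -
  have [measurable]: "f n \<in> borel_measurable M" for n by (rule L2_measurable[OF L])
  have "\<exists>r. \<forall>k. \<forall>m\<ge>r k. \<forall>n\<ge>r k. L2norm M (\<lambda>x. f m x - f n x) < (1/2)^k"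
    by (intro choice allI C) simp
  then obtain N where N: "\<And>k m n. m \<ge> N k \<Longrightarrow> n \<ge> N k \<Longrightarrow> L2norm M (\<lambda>x. f m x - f n x) < (1/2)^k"
    by blast
  \<comment> \<open>The maximum makes \<open>r\<close> strictly increasing and keeps
    \<open>r k\<close> beyond the threshold \<open>N k\<close>.\<close>
  define r where "r = rec_nat (N 0) (\<lambda>k a. max (Suc a) (N (Suc k)))"
  have r_Suc: "r (Suc k) = max (Suc (r k)) (N (Suc k))" for k by (simp add: r_def)
  have sm: "strict_mono r" by (simp add: strict_mono_Suc_iff r_Suc less_max_iff_disj)
  have rN: "r k \<ge> N k" for k by (cases k) (simp_all add: r_Suc, simp add: r_def)
  define d where "d k x = norm (f (r (Suc k)) x - f (r k) x)" for k x
  have [measurable]: "d k \<in> borel_measurable M" for k unfolding d_def by measurable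
  have d_nonneg: "0 \<le> d k x" for k x by (simp add: d_def)
  have di: "integrable M (d k)" for k
    unfolding d_def by (intro integrable_norm L2_integrable L2_diff L)
  have "(LINT x|M. d k x) \<le> sqrt (measure M (space M)) * (1/2)^k" for k
  proof -
    have "L2norm M (\<lambda>x. f (r (Suc k)) x - f (r k) x) < (1/2)^k"
      by (rule N) (use rN[of k] r_Suc[of k] in auto)
    moreover have "(LINT x|M. d k x) \<le> sqrt (measure M (space M)) * L2norm M (\<lambda>x. f (r (Suc k)) x - f (r k) x)"
      unfolding d_def by (intro L1_le_L2norm L2_diff L)
    ultimately show ?thesis
      by (meson less_imp_le mult_left_mono order_trans real_sqrt_ge_zero measure_nonneg)
  qed
  then have nn: "(\<integral>\<^sup>+x. ennreal (d k x) \<partial>M) \<le> ennreal (sqrt (measure M (space M)) * (1/2)^k)" for k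
    using di by (subst nn_integral_eq_integral) (auto simp: d_nonneg intro!: ennreal_leI)
  have "(\<integral>\<^sup>+x. (\<Sum>k. ennreal (d k x)) \<partial>M) = (\<Sum>k. \<integral>\<^sup>+x. ennreal (d k x) \<partial>M)"
    by (rule nn_integral_suminf) simp
  also have "\<dots> \<le> (\<Sum>k. ennreal (sqrt (measure M (space M)) * (1/2)^k))"
    by (intro suminf_le nn) auto
  also have "\<dots> = ennreal (\<Sum>k. sqrt (measure M (space M)) * (1/2)^k)"
    by (rule suminf_ennreal_eq) (auto intro!: summable_sums summable_mult summable_geometric)
  also have "\<dots> < \<infinity>" by simp
  finally have "AE x in M. (\<Sum>k. ennreal (d k x)) \<noteq> \<infinity>"
    by (intro nn_integral_noteq_infinite) auto
  then have conv: "AE x in M. convergent (\<lambda>k. f (r k) x)"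
  proof eventually_elim
    case (elim x)
    then have "summable (\<lambda>k. d k x)"
      by (intro summable_suminf_not_top) (auto simp: d_def)
    then have "summable (\<lambda>k. f (r (Suc k)) x - f (r k) x)"
      unfolding d_def by (rule summable_norm_cancel)
    then have "convergent (\<lambda>n. \<Sum>k<n. f (r (Suc k)) x - f (r k) x)"
      by (simp add: summable_iff_convergent)
    then have "convergent (\<lambda>n. f (r n) x - f (r 0) x)"
      by (simp add: sum_lessThan_telescope[of "\<lambda>k. f (r k) x"])
    then show ?case by (simp add: convergent_diff_const_right_iff)
  qed
  define g where "g x = lim (\<lambda>k. f (r k) x)" for x
  have gm[measurable]: "g \<in> borel_measurable M" unfolding g_def by (rule borel_measurable_lim_metric) simp
  have ae: "AE x in M. (\<lambda>k. f (r k) x) \<longlonglongrightarrow> g x"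
    using conv by eventually_elim (simp add: g_def convergent_LIMSEQ_iff)
  \<comment> \<open>The Cauchy bound between \<open>f n\<close> and \<open>f (r k)\<close> survives
    the limit in \<open>k\<close>. It is stated with the nonnegative integral because
    \<open>f n - g\<close> is not yet known to lie in L2; that is deduced from this bound.\<close>
  have fatou: "(\<integral>\<^sup>+x. ennreal ((norm (f n x - g x))\<^sup>2) \<partial>M) \<le> ennreal (((1/2)^j)\<^sup>2)"
    if n: "n \<ge> N j" for n j
  proof -
    have "(\<integral>\<^sup>+x. ennreal ((norm (f n x - g x))\<^sup>2) \<partial>M)
        = (\<integral>\<^sup>+x. liminf (\<lambda>k. ennreal ((norm (f n x - f (r k) x))\<^sup>2)) \<partial>M)"
    proof (rule nn_integral_cong_AE, use ae in eventually_elim)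
      case (elim x)
      have "(\<lambda>k. ennreal ((norm (f n x - f (r k) x))\<^sup>2)) \<longlonglongrightarrow> ennreal ((norm (f n x - g x))\<^sup>2)"
        by (intro tendsto_ennrealI tendsto_intros elim)
      then show ?case by (intro lim_imp_Liminf[symmetric]) simp_all
    qed
    also have "\<dots> \<le> liminf (\<lambda>k. \<integral>\<^sup>+x. ennreal ((norm (f n x - f (r k) x))\<^sup>2) \<partial>M)"
      by (rule nn_integral_liminf) simp
    also have "\<dots> \<le> ennreal (((1/2)^j)\<^sup>2)"
    proof (rule Liminf_le, simp, rule eventually_sequentiallyI[of "N j"])
      fix k assume "k \<ge> N j"
      then have "r k \<ge> N j" using seq_suble[OF sm, of k] by linarith
      then have "L2norm M (\<lambda>x. f n x - f (r k) x) < (1/2)^j" using n N by blast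
      then have "(L2norm M (\<lambda>x. f n x - f (r k) x))\<^sup>2 \<le> ((1/2)^j)\<^sup>2"
        by (intro power_mono) (auto simp: L2norm_nonneg)
      then show "(\<integral>\<^sup>+x. ennreal ((norm (f n x - f (r k) x))\<^sup>2) \<partial>M) \<le> ennreal (((1/2)^j)\<^sup>2)"
        by (subst nn_integral_eq_integral)
          (auto simp: L2norm_sq intro!: ennreal_leI L2_norm_sq_integrable L2_diff L)
    qed
    finally show ?thesis .
  qed
  have dL: "L2 M (\<lambda>x. f n x - g x)" if "n \<ge> N j" for n j
    unfolding L2_def
  proof (intro conjI integrableI_bounded)
    show "(\<integral>\<^sup>+x. ennreal (norm ((norm (f n x - g x))\<^sup>2)) \<partial>M) < \<infinity>"
      using le_less_trans[OF fatou[OF that]] by simp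
  qed measurable
  have "L2 M (\<lambda>x. f (N 0) x - (f (N 0) x - g x))" by (intro L2_diff L dL[of 0]) simp
  then have gL: "L2 M g" by simp
  moreover have "(\<lambda>n. L2norm M (\<lambda>x. f n x - g x)) \<longlonglongrightarrow> 0"
  proof (rule LIMSEQ_I)
    fix e :: real assume "e > 0"
    then obtain j where j: "(1/2)^j < e" using real_arch_pow_inv[of e "1/2"] by auto
    show "\<exists>no. \<forall>n\<ge>no. norm (L2norm M (\<lambda>x. f n x - g x) - 0) < e"
    proof (intro exI allI impI)
      fix n assume n: "n \<ge> N j"
      have "(\<integral>\<^sup>+x. ennreal ((norm (f n x - g x))\<^sup>2) \<partial>M) = ennreal ((L2norm M (\<lambda>x. f n x - g x))\<^sup>2)"
        unfolding L2norm_sq by (rule nn_integral_eq_integral[OF L2_norm_sq_integrable[OF dL[OF n]]]) simp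
      then have "(L2norm M (\<lambda>x. f n x - g x))\<^sup>2 \<le> ((1/2)^j)\<^sup>2"
        using fatou[OF n] by (metis ennreal_le_iff zero_le_power2)
      then have "L2norm M (\<lambda>x. f n x - g x) \<le> (1/2)^j"
        by (rule power2_le_imp_le) simp
      then show "norm (L2norm M (\<lambda>x. f n x - g x) - 0) < e"
        using j by (simp add: L2norm_nonneg)
    qed
  qed
  ultimately show ?thesis by (rule that)
qed

section \<open>Smooth bump functions\<close>

text \<open>The product rule keeps undifferentiated factors, of order \<open>Suc k\<close>, where
  the induction hypothesis wants order \<open>k\<close>.\<close>

lemma Ck_on_Suc_imp: "Ck_on (Suc k) S f \<Longrightarrow> Ck_on k S f"
proof (induction k arbitrary: f)
  case 0
  then show ?case by (auto intro: differentiable_imp_continuous_on)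
next
  case (Suc k)
  from Suc.prems have "f differentiable_on S"
    and "\<And>i. Ck_on (Suc k) S (\<lambda>x. frechet_derivative f (at x) (axis i 1))"
    by (simp_all del: Ck_on.simps add: Ck_on.simps(2)[of "Suc k"])
  then show ?case using Suc.IH by (simp only: Ck_on.simps(2)[of k S f]) blast
qed

section \<open>Sums and products of smooth functions\<close>

lemma differentiable_on_UNIV_has_derivative:
  "f differentiable_on UNIV \<Longrightarrow> (f has_derivative frechet_derivative f (at x)) (at x)"
  by (simp add: differentiable_on_def frechet_derivative_works)

lemma frechet_derivative_lin:
  fixes f g :: "'a::real_normed_vector \<Rightarrow> real"
  assumes "f differentiable_on UNIV" "g differentiable_on UNIV"
  shows "frechet_derivative (\<lambda>x. a * f x + b * g x) (at x)
       = (\<lambda>h. a * frechet_derivative f (at x) h + b * frechet_derivative g (at x) h)"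
  by (intro frechet_derivative_at[symmetric] has_derivative_add has_derivative_mult_right
      differentiable_on_UNIV_has_derivative assms)

lemma frechet_derivative_mult:
  fixes f g :: "'a::real_normed_vector \<Rightarrow> real"
  assumes "f differentiable_on UNIV" "g differentiable_on UNIV"
  shows "frechet_derivative (\<lambda>x. f x * g x) (at x)
       = (\<lambda>h. f x * frechet_derivative g (at x) h + g x * frechet_derivative f (at x) h)"
proof (rule frechet_derivative_at[symmetric])
  show "((\<lambda>x. f x * g x) has_derivative
      (\<lambda>h. f x * frechet_derivative g (at x) h + g x * frechet_derivative f (at x) h)) (at x)"
    using has_derivative_mult[OF assms[THEN differentiable_on_UNIV_has_derivative]]
    by (rule has_derivative_eq_rhs) (simp add: fun_eq_iff)
qed

lemma differentiable_on_UNIV_lin: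
  fixes f g :: "'a::real_normed_vector \<Rightarrow> real"
  assumes "f differentiable_on UNIV" "g differentiable_on UNIV"
  shows "(\<lambda>x. a * f x + b * g x) differentiable_on UNIV"
  using assms by (auto simp: differentiable_on_def intro!: derivative_intros)

lemma differentiable_on_UNIV_mult:
  fixes f g :: "'a::real_normed_vector \<Rightarrow> real"
  assumes "f differentiable_on UNIV" "g differentiable_on UNIV"
  shows "(\<lambda>x. f x * g x) differentiable_on UNIV"
  using assms by (auto simp: differentiable_on_def intro!: derivative_intros)

lemma Ck_on_lin:
  "Ck_on k UNIV f \<Longrightarrow> Ck_on k UNIV g \<Longrightarrow> Ck_on k UNIV (\<lambda>x. a * f x + b * g x)"
proof (induction k arbitrary: f g)
  case 0
  then show ?case by (auto intro!: continuous_intros)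
next
  case (Suc k)
  then show ?case
    by (simp add: frechet_derivative_lin differentiable_on_UNIV_lin)
qed

lemma Ck_on_mult:
  "Ck_on k UNIV f \<Longrightarrow> Ck_on k UNIV g \<Longrightarrow> Ck_on k UNIV (\<lambda>x. f x * g x)"
proof (induction k arbitrary: f g)
  case 0
  then show ?case by (auto intro!: continuous_intros)
next
  case (Suc k)
  from Suc.prems have df: "f differentiable_on UNIV" "g differentiable_on UNIV"
    and pf: "Ck_on k UNIV (\<lambda>x. frechet_derivative f (at x) (axis i 1))"
    and pg: "Ck_on k UNIV (\<lambda>x. frechet_derivative g (at x) (axis i 1))" for i
    by simp_all
  have "Ck_on k UNIV (\<lambda>x. 1 * (f x * frechet_derivative g (at x) (axis i 1))
                          + 1 * (g x * frechet_derivative f (at x) (axis i 1)))" for i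
    by (rule Ck_on_lin[OF Suc.IH[OF Ck_on_Suc_imp[OF Suc.prems(1)] pg]
          Suc.IH[OF Ck_on_Suc_imp[OF Suc.prems(2)] pf]])
  then have "Ck_on k UNIV (\<lambda>x. frechet_derivative (\<lambda>x. f x * g x) (at x) (axis i 1))" for i
    by (simp only: frechet_derivative_mult[OF df] mult_1_left)
  then show ?case
    using differentiable_on_UNIV_mult[OF df] by simp
qed

lemma Ck_on_const: "Ck_on k UNIV (\<lambda>x. c)"
proof (induction k arbitrary: c)
  case (Suc k)
  then show ?case by (simp add: frechet_derivative_const)
qed simp

lemma Ck_on_prod:
  "finite I \<Longrightarrow> (\<And>i. i \<in> I \<Longrightarrow> Ck_on k UNIV (f i)) \<Longrightarrow> Ck_on k UNIV (\<lambda>x. \<Prod>i\<in>I. f i x)"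
proof (induction I rule: finite_induct)
  case empty
  show ?case by (simp add: Ck_on_const del: Ck_on.simps)
next
  case (insert i I)
  have "Ck_on k UNIV (\<lambda>x. f i x * (\<Prod>i\<in>I. f i x))"
    by (intro Ck_on_mult insert) simp_all
  with insert show ?case by simp
qed

text \<open>The classical flat function \<open>exp (- 1/t)\<close>, multiplied by powers of
  \<open>1/t\<close> so that the family is closed under differentiation up to linear combinations.
  Smoothness of every order then follows by induction from the single formula
  \<open>eta_deriv\<close>.\<close>

definition eta :: "nat \<Rightarrow> real \<Rightarrow> real" where
  "eta m t = (if t > 0 then (1/t)^m * exp (- (1/t)) else 0)"

text \<open>With \<open>s = 1/t\<close>, one term of the exponential series gives
  \<open>s^(m+2) / fact (m+2) \<le> exp s\<close>. The two surplus powers of \<open>s\<close> become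
  the factor \<open>t\<^sup>2\<close>, which forces the difference quotient at 0 to vanish.\<close>

lemma eta_bound: "\<bar>eta m t\<bar> \<le> fact (m + 2) * t\<^sup>2"
proof (cases "t > 0")
  case True
  define s where "s = 1/t"
  have s: "s > 0" using True by (simp add: s_def)
  have "s^(m+2) / fact (m+2) \<le> exp s"
    using sum_le_suminf[OF summable_exp, of "{m+2}" s] s
    by (simp add: exp_def divide_inverse mult.commute)
  then have "s^(m+2) \<le> fact (m+2) * exp s"
    by (simp only: pos_divide_le_eq[OF fact_gt_zero] mult.commute)
  then have "s^(m+2) * exp (-s) \<le> fact (m+2)"
    by (simp only: exp_minus divide_inverse[symmetric] pos_divide_le_eq[OF exp_gt_zero])
  then have "s^m * exp (-s) * s\<^sup>2 \<le> fact (m+2)"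
    by (simp add: power2_eq_square mult_ac del: fact_Suc)
  then have "s^m * exp (-s) \<le> fact (m+2) / s\<^sup>2"
    using s by (simp only: pos_le_divide_eq zero_less_power)
  then show ?thesis
    using True s by (simp add: eta_def s_def power_divide)
qed (simp add: eta_def)

lemma eta_deriv: "(eta m has_real_derivative (eta (m+2) t - m * eta (m+1) t)) (at t)"
proof -
  consider "t > 0" | "t < 0" | "t = 0" by linarith
  then show ?thesis
  proof cases
    case 1
    have r: "((\<lambda>t. 1/t) has_real_derivative - ((1/t)^2)) (at t)"
      using 1 by (auto intro!: derivative_eq_intros simp: power2_eq_square)
    have "((\<lambda>t. (1/t)^m) has_real_derivative - (real m * (1/t)^(m+1))) (at t)"
    proof (cases m)
      case (Suc k)
      show ?thesis using DERIV_power_Suc[OF r, of k] by (simp add: Suc power2_eq_square algebra_simps)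
    qed simp
    moreover have "((\<lambda>t. exp (- (1/t))) has_real_derivative exp (- (1/t)) * (1/t)^2) (at t)"
      using DERIV_chain2[OF DERIV_exp DERIV_minus[OF r]] by simp
    ultimately have "((\<lambda>t. (1/t)^m * exp (- (1/t))) has_real_derivative
        - (real m * (1/t)^(m+1)) * exp (- (1/t)) + exp (- (1/t)) * (1/t)^2 * (1/t)^m) (at t)"
      by (rule DERIV_mult)
    also have "- (real m * (1/t)^(m+1)) * exp (- (1/t)) + exp (- (1/t)) * (1/t)^2 * (1/t)^m
        = eta (m+2) t - m * eta (m+1) t"
      using 1 by (simp add: eta_def power_add power2_eq_square mult_ac)
    finally have "((\<lambda>t. (1/t)^m * exp (- (1/t))) has_real_derivative (eta (m+2) t - m * eta (m+1) t)) (at t)" .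
    then show ?thesis
      by (rule has_field_derivative_transform_within_open[where S = "{0<..}"])
        (use 1 in \<open>auto simp: eta_def\<close>)
  next
    case 2
    have "((\<lambda>t. 0) has_real_derivative (eta (m+2) t - m * eta (m+1) t)) (at t)"
      using 2 by (simp add: eta_def)
    then show ?thesis
      by (rule has_field_derivative_transform_within_open[where S = "{..<0}"])
        (use 2 in \<open>auto simp: eta_def\<close>)
  next
    case 3
    have "((\<lambda>h. eta m h / h) \<longlongrightarrow> 0) (at 0)"
    proof (rule Lim_null_comparison)
      show "\<forall>\<^sub>F h in at 0. norm (eta m h / h) \<le> fact (m+2) * \<bar>h\<bar>"
        unfolding eventually_at_filter
      proof (intro always_eventually allI impI)
        fix h :: real assume "h \<noteq> 0"
        then show "norm (eta m h / h) \<le> fact (m+2) * \<bar>h\<bar>"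
          using eta_bound[of m h]
          by (simp add: abs_divide pos_divide_le_eq mult.assoc flip: power2_eq_square del: fact_Suc)
      qed
      show "((\<lambda>h::real. fact (m+2) * \<bar>h\<bar>) \<longlongrightarrow> 0) (at 0)"
        by (auto intro!: tendsto_eq_intros)
    qed
    then show ?thesis using 3 by (simp add: DERIV_def eta_def)
  qed
qed

lemma has_derivative_eta_coord:
  fixes i :: 3
  shows "((\<lambda>x. eta m (c * x $ i + d)) has_derivative
     (\<lambda>h. (eta (m+2) (c * x $ i + d) - m * eta (m+1) (c * x $ i + d)) * (c * h $ i))) (at x)"
proof -
  have "((\<lambda>x::R3. c * x $ i + d) has_derivative (\<lambda>h. c * h $ i)) (at x)"
    by (auto intro!: derivative_eq_intros bounded_linear_vec_nth bounded_linear_imp_has_derivative)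
  from has_derivative_compose[OF this eta_deriv[unfolded has_field_derivative_def]]
  show ?thesis by simp
qed

text \<open>Differentiation raises the index to \<open>m+1\<close> and \<open>m+2\<close>, hence the
  induction over \<open>k\<close> with \<open>m\<close> arbitrary.\<close>

lemma Ck_on_eta_coord: "Ck_on k UNIV (\<lambda>x::R3. eta m (c * x $ i + d))"
proof (induction k arbitrary: m)
  case 0
  show ?case
    using has_derivative_eta_coord[of m c i d]
    by (auto intro!: continuous_at_imp_continuous_on intro: has_derivative_continuous)
next
  case (Suc k)
  have "frechet_derivative (\<lambda>x. eta m (c * x $ i + d)) (at x) (axis j 1)
    = (c * axis j 1 $ i) * eta (m+2) (c * x $ i + d) + (- (m * (c * axis j 1 $ i))) * eta (m+1) (c * x $ i + d)"
    for x j
    by (subst frechet_derivative_at[OF has_derivative_eta_coord, symmetric]) (simp add: algebra_simps)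
  moreover have "(\<lambda>x. eta m (c * x $ i + d)) differentiable_on UNIV"
    unfolding differentiable_on_def differentiable_def using has_derivative_eta_coord by blast
  ultimately show ?case
    by (simp only: Ck_on.simps simp_thms) (rule allI, rule Ck_on_lin[OF Suc.IH Suc.IH])
qed

lemma eta_0_tendsto: "(\<lambda>n. eta 0 (real (Suc n) * t)) \<longlonglongrightarrow> (if t > 0 then 1 else 0)"
proof (cases "t > 0")
  case True
  have "(\<lambda>n. exp (- ((1/t) * (1 / real (Suc n))))) \<longlonglongrightarrow> exp (- ((1/t) * 0))"
    by (intro tendsto_intros LIMSEQ_Suc[OF lim_1_over_n])
  then show ?thesis using True by (simp add: eta_def mult.commute)
qed (simp add: eta_def zero_less_mult_iff)

lemma eta_0_bounds: "0 \<le> eta 0 t" "eta 0 t \<le> 1"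
  by (auto simp: eta_def)

text \<open>As \<open>eta 0 (n t) = exp (- 1 / (n t))\<close> tends to \<open>1\<close> for \<open>t > 0\<close>, rescaling alone turns the bumps into
  indicators of boxes, without enlarging their support.\<close>

definition bump :: "R3 \<Rightarrow> R3 \<Rightarrow> nat \<Rightarrow> R3 \<Rightarrow> real" where
  "bump a b n x = (\<Prod>i\<in>UNIV. eta 0 (real (Suc n) * x $ i + - (real (Suc n) * a $ i))
                            * eta 0 (- real (Suc n) * x $ i + real (Suc n) * b $ i))"

text \<open>The definition writes the arguments as \<open>c * x $ i + d\<close> to fit
  \<open>Ck_on_eta_coord\<close>; this form shows the signed distances to the faces of the
  box.\<close>

lemma bump_eq:
  "bump a b n x = (\<Prod>i\<in>UNIV. eta 0 (real (Suc n) * (x $ i - a $ i)) * eta 0 (real (Suc n) * (b $ i - x $ i)))"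
  unfolding bump_def by (intro prod.cong refl arg_cong2[of _ _ _ _ "(*)"] arg_cong[of _ _ "eta 0"]) (auto simp: algebra_simps)

lemma mem_box_R3: "x \<in> box a b \<longleftrightarrow> (\<forall>i. a $ i < x $ i \<and> x $ i < b $ i)" for x :: R3
  by (simp add: mem_box_cart)

lemma bump_outside:
  assumes "x \<notin> box a b" shows "bump a b n x = 0"
proof -
  from assms obtain i where "x $ i - a $ i \<le> 0 \<or> b $ i - x $ i \<le> 0"
    by (auto simp: mem_box_R3 not_less)
  then have "\<exists>i. eta 0 (real (Suc n) * (x $ i - a $ i)) * eta 0 (real (Suc n) * (b $ i - x $ i)) = 0"
    by (intro exI[of _ i]) (auto simp: eta_def zero_less_mult_iff)
  then show ?thesis unfolding bump_eq by auto
qed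

lemma bump_bounds: "0 \<le> bump a b n x" "bump a b n x \<le> 1"
  unfolding bump_eq
  by (auto intro!: prod_nonneg prod_le_1 mult_nonneg_nonneg mult_le_one simp: eta_0_bounds)

lemma bump_tendsto: "(\<lambda>n. bump a b n x) \<longlonglongrightarrow> indicator (box a b) x"
proof (cases "x \<in> box a b")
  case True
  have "(\<lambda>n. bump a b n x) \<longlonglongrightarrow> (\<Prod>i\<in>UNIV. (if x $ i - a $ i > 0 then 1 else 0) * (if b $ i - x $ i > 0 then 1 else 0))"
    unfolding bump_eq by (intro tendsto_prod tendsto_mult eta_0_tendsto)
  then show ?thesis using True by (simp add: mem_box_R3)
qed (simp add: bump_outside)

lemma smooth_bump: "smooth_on UNIV (bump a b n)"
  unfolding smooth_on_def bump_def
  by (rule allI, rule Ck_on_prod[OF finite], rule Ck_on_mult[OF Ck_on_eta_coord Ck_on_eta_coord])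

text \<open>Any compact subset of the domain outside which \<open>f\<close> vanishes will do, so the
  exact support of a sum or a bump never has to be computed.\<close>

lemma test_fun_iff:
  "test_fun \<Omega> f \<longleftrightarrow> smooth_on UNIV f \<and> (\<exists>C. compact C \<and> C \<subseteq> \<Omega> \<and> (\<forall>x. x \<notin> C \<longrightarrow> f x = 0))"
proof safe
  assume "test_fun \<Omega> f"
  then show "smooth_on UNIV f" "\<exists>C. compact C \<and> C \<subseteq> \<Omega> \<and> (\<forall>x. x \<notin> C \<longrightarrow> f x = 0)"
    unfolding test_fun_def
    by (auto intro!: exI[of _ "closure {x. f x \<noteq> 0}"] closure_subset[THEN subsetD])
next
  fix C assume f: "smooth_on UNIV f" and C: "compact C" "C \<subseteq> \<Omega>" "\<forall>x. x \<notin> C \<longrightarrow> f x = 0"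
  then have "closure {x. f x \<noteq> 0} \<subseteq> C"
    by (intro closure_minimal compact_imp_closed) auto
  moreover from this have "compact (closure {x. f x \<noteq> 0})"
    using C(1) by (meson bounded_subset compact_eq_bounded_closed closed_closure)
  ultimately show "test_fun \<Omega> f"
    using f C by (auto simp: test_fun_def)
qed

lemma test_fun_bump: "cbox a b \<subseteq> \<Omega> \<Longrightarrow> test_fun \<Omega> (bump a b n)"
  unfolding test_fun_iff using smooth_bump box_subset_cbox[of a b]
  by (intro conjI exI[of _ "cbox a b"] allI impI bump_outside) auto

lemma test_fun_lin:
  assumes "test_fun \<Omega> f" "test_fun \<Omega> g"
  shows "test_fun \<Omega> (\<lambda>x. a * f x + b * g x)"
proof -
  from assms obtain C D where "smooth_on UNIV f" "smooth_on UNIV g"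
    "compact C" "C \<subseteq> \<Omega>" "\<forall>x. x \<notin> C \<longrightarrow> f x = 0" "compact D" "D \<subseteq> \<Omega>" "\<forall>x. x \<notin> D \<longrightarrow> g x = 0"
    unfolding test_fun_iff by blast
  then show ?thesis
    unfolding test_fun_iff smooth_on_def
    by (auto intro!: Ck_on_lin exI[of _ "C \<union> D"] compact_Un)
qed

lemma test_fun_zero: "test_fun \<Omega> (\<lambda>x. 0)"
  by (auto simp: test_fun_iff smooth_on_def Ck_on_const intro!: exI[of _ "{}"])

lemma smooth_on_differentiable: "smooth_on UNIV f \<Longrightarrow> f differentiable_on UNIV"
  unfolding smooth_on_def using Ck_on.simps(2)[of 0 UNIV f] by blast

lemma smooth_on_continuous_pd: "smooth_on UNIV f \<Longrightarrow> continuous_on UNIV (pd i f)"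
  unfolding smooth_on_def pd_def[abs_def] using Ck_on.simps(2)[of 0 UNIV f] by simp

section \<open>Integration by parts\<close>

definition grad :: "(R3 \<Rightarrow> real) \<Rightarrow> R3 \<Rightarrow> R3" where
  "grad f x = (\<chi> i. pd i f x)"

lemma grad_nth [simp]: "grad f x $ i = pd i f x"
  by (simp add: grad_def)

lemma has_derivative_line:
  assumes "f differentiable_on UNIV"
  shows "((\<lambda>t. f (x + t *\<^sub>R axis i 1)) has_real_derivative pd i f (x + t *\<^sub>R axis i 1)) (at t)"
proof -
  let ?D = "frechet_derivative f (at (x + t *\<^sub>R axis i 1))"
  have D: "(f has_derivative ?D) (at (x + t *\<^sub>R axis i 1))"
    by (rule differentiable_on_UNIV_has_derivative[OF assms])
  have "((\<lambda>t. x + t *\<^sub>R axis i 1) has_derivative (\<lambda>h. h *\<^sub>R axis i 1)) (at t)"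
    by (auto intro!: derivative_eq_intros)
  from has_derivative_compose[OF this D]
  have "((\<lambda>t. f (x + t *\<^sub>R axis i 1)) has_derivative (\<lambda>h. ?D (h *\<^sub>R axis i 1))) (at t)" .
  moreover have "?D (h *\<^sub>R axis i 1) = pd i f (x + t *\<^sub>R axis i 1) * h" for h
    using linear_scale[OF has_derivative_linear[OF D]] by (simp add: pd_def)
  ultimately show ?thesis
    by (simp add: has_field_derivative_def)
qed

lemma pd_outside:
  assumes "closed C" "\<And>x. x \<notin> C \<Longrightarrow> f x = 0" "x \<notin> C"
  shows "pd i f x = 0"
proof -
  have "((\<lambda>_. 0) has_derivative (\<lambda>_. 0)) (at x)" by simp
  then have "(f has_derivative (\<lambda>_. 0)) (at x)"
    by (rule has_derivative_transform_within_open[of _ _ _ _ "- C"]) (use assms in auto)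
  then show ?thesis
    by (simp add: pd_def frechet_derivative_at[symmetric])
qed

lemma pd_lin:
  assumes "f differentiable_on UNIV" "g differentiable_on UNIV"
  shows "pd i (\<lambda>x. a * f x + b * g x) x = a * pd i f x + b * pd i g x"
  using assms by (simp add: pd_def frechet_derivative_lin)

lemma pd_mult:
  assumes "f differentiable_on UNIV" "g differentiable_on UNIV"
  shows "pd i (\<lambda>x. f x * g x) x = f x * pd i g x + g x * pd i f x"
  using assms by (simp add: pd_def frechet_derivative_mult)

lemma continuous_compact_support:
  fixes f :: "R3 \<Rightarrow> 'b::euclidean_space"
  assumes "continuous_on UNIV f" "compact C" "\<And>x. x \<notin> C \<Longrightarrow> f x = 0"
  shows "integrable lborel f" "\<exists>B. \<forall>x. norm (f x) \<le> B"
proof -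
  have "integrable lborel (\<lambda>x. indicator C x *\<^sub>R f x)"
    using assms by (intro borel_integrable_compact continuous_on_subset[OF assms(1)]) auto
  moreover have "(\<lambda>x. indicator C x *\<^sub>R f x) = f"
    using assms(3) by (auto simp: fun_eq_iff indicator_def)
  ultimately show "integrable lborel f" by simp
  have "bounded (f ` C)"
    using assms by (intro compact_imp_bounded compact_continuous_image) (auto intro: continuous_on_subset)
  then obtain B where "\<And>x. x \<in> C \<Longrightarrow> norm (f x) \<le> B"
    by (auto simp: bounded_iff)
  then have "norm (f x) \<le> max B 0" for x
    by (cases "x \<in> C") (auto simp: assms(3) le_max_iff_disj)
  then show "\<exists>B. \<forall>x. norm (f x) \<le> B" by blast
qed

lemma lborel_integral_translate:
  fixes f :: "R3 \<Rightarrow> real"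
  assumes "f \<in> borel_measurable borel"
  shows "(LINT x|lborel. f (x + c)) = (LINT x|lborel. f x)"
    "integrable lborel f \<Longrightarrow> integrable lborel (\<lambda>x. f (x + c))"
proof -
  have d: "distr lborel borel ((+) c) = (lborel :: R3 measure)" by (rule lborel_distr_plus)
  have "(LINT x|lborel. f x) = (LINT x|distr lborel borel ((+) c). f x)" by (simp add: d)
  also have "\<dots> = (LINT x|lborel. f (c + x))"
    using assms by (intro integral_distr) auto
  finally show "(LINT x|lborel. f (x + c)) = (LINT x|lborel. f x)"
    by (simp add: add.commute)
  assume "integrable lborel f"
  then have "integrable (distr lborel borel ((+) c)) f" by (simp add: d)
  then show "integrable lborel (\<lambda>x. f (x + c))"
    using assms by (subst (asm) integrable_distr_eq) (auto simp: add.commute)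
qed

text \<open>Difference quotients have integral zero by translation invariance, and converge dominatedly.\<close>

lemma integral_pd_eq_0:
  assumes f: "f differentiable_on UNIV" and pf: "continuous_on UNIV (pd i f)"
    and C: "compact C" "\<And>x. x \<notin> C \<Longrightarrow> f x = 0"
  shows "(LINT x|lborel. pd i f x) = 0"
proof -
  define e :: R3 where "e = axis i 1"
  have ne: "norm e = 1" by (simp add: e_def)
  have fc: "continuous_on UNIV f" by (rule differentiable_imp_continuous_on[OF f])
  then have [measurable]: "f \<in> borel_measurable borel" by (rule borel_measurable_continuous_onI)
  have [measurable]: "pd i f \<in> borel_measurable borel" by (rule borel_measurable_continuous_onI[OF pf])
  have p0: "x \<notin> C \<Longrightarrow> pd i f x = 0" for x
    by (rule pd_outside[OF compact_imp_closed[OF C(1)] C(2)])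
  obtain B where B: "\<And>x. \<bar>pd i f x\<bar> \<le> B"
    using continuous_compact_support(2)[OF pf C(1) p0] by auto
  obtain R where R: "C \<subseteq> cball 0 R"
    using compact_imp_bounded[OF C(1)] by (auto simp: bounded_iff subset_iff)
  define q where "q n x = real (Suc n) * (f (x + (1 / real (Suc n)) *\<^sub>R e) - f x)" for n x
  have fi: "integrable lborel f" by (rule continuous_compact_support[OF fc C])
  have q0: "(LINT x|lborel. q n x) = 0" for n
    unfolding q_def using fi lborel_integral_translate[of f] by simp
  \<comment> \<open>The mean value theorem yields the domination: quotients are bounded by
    \<open>B\<close> uniformly in \<open>n\<close>, and the intermediate point is within distance 1
    of \<open>x\<close>, which explains the radius \<open>R + 1\<close> below.\<close>
  have mv: "\<exists>s. 0 < s \<and> s < 1 \<and> q n x = pd i f (x + s *\<^sub>R e)" for n x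
  proof -
    define d where "d = 1 / real (Suc n)"
    have d: "0 < d" "d \<le> 1" by (simp_all add: d_def)
    obtain s where "0 < s" "s < d" "f (x + d *\<^sub>R e) - f (x + 0 *\<^sub>R e) = (d - 0) * pd i f (x + s *\<^sub>R e)"
      using MVT2[OF d(1), of "\<lambda>t. f (x + t *\<^sub>R e)" "\<lambda>t. pd i f (x + t *\<^sub>R e)"]
        has_derivative_line[OF f] unfolding e_def by blast
    with d show ?thesis
      by (intro exI[of _ s]) (simp add: q_def d_def[symmetric], simp add: d_def field_simps)
  qed
  have qb: "\<bar>q n x\<bar> \<le> B * indicator (cball 0 (R + 1)) x" for n x
  proof (cases "x \<in> cball 0 (R + 1)")
    case True
    then show ?thesis using mv[of n x] B by auto
  next
    case False
    obtain s where s: "0 < s" "s < 1" "q n x = pd i f (x + s *\<^sub>R e)" using mv by blast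
    have "norm x \<le> norm (x + s *\<^sub>R e) + norm (s *\<^sub>R e)"
      by (metis add_diff_cancel_right' norm_triangle_ineq4)
    then have "x + s *\<^sub>R e \<notin> C" using s(1,2) False R ne by (auto simp: subset_iff)
    then show ?thesis using s(3) p0 False by simp
  qed
  have lim: "(\<lambda>n. q n x) \<longlonglongrightarrow> pd i f x" for x
  proof -
    have "((\<lambda>h. (f (x + h *\<^sub>R e) - f x) / h) \<longlongrightarrow> pd i f x) (at 0)"
      using has_derivative_line[OF f, of x i 0] by (simp add: DERIV_def e_def)
    moreover have "filterlim (\<lambda>n. 1 / real (Suc n)) (at 0) sequentially"
      using LIMSEQ_Suc[OF lim_1_over_n] by (auto simp: filterlim_at)
    ultimately have "((\<lambda>n. (f (x + (1 / real (Suc n)) *\<^sub>R e) - f x) / (1 / real (Suc n))) \<longlonglongrightarrow> pd i f x)"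
      by (rule filterlim_compose)
    then show ?thesis by (simp add: q_def mult.commute)
  qed
  have "(\<lambda>n. LINT x|lborel. q n x) \<longlonglongrightarrow> (LINT x|lborel. pd i f x)"
  proof (rule integral_dominated_convergence)
    show "integrable lborel (\<lambda>x. B * indicator (cball (0::R3) (R + 1)) x)"
      by (intro integrable_mult_right integrable_real_indicator) (simp_all add: emeasure_lborel_cball_finite[unfolded infinity_ennreal_def])
  qed (use lim qb in \<open>auto simp: q_def\<close>)
  then show ?thesis
    unfolding q0 by (simp add: LIMSEQ_const_iff)
qed

text \<open>The product has integral zero of its derivative once a single factor has compact
  support. This asymmetry lets \<open>g\<close> be a coordinate function in the Poincare
  inequality.\<close>

lemma integration_by_parts:
  assumes f: "f differentiable_on UNIV" and pf: "continuous_on UNIV (pd i f)"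
    and C: "compact C" "\<And>x. x \<notin> C \<Longrightarrow> f x = 0"
    and g: "g differentiable_on UNIV" and pg: "continuous_on UNIV (pd i g)"
  shows "(LINT x|lborel. f x * pd i g x) = - (LINT x|lborel. pd i f x * g x)"
proof -
  note fc = differentiable_imp_continuous_on[OF f] and gc = differentiable_imp_continuous_on[OF g]
  have p0: "x \<notin> C \<Longrightarrow> pd i f x = 0" for x
    by (rule pd_outside[OF compact_imp_closed[OF C(1)] C(2)])
  have e: "pd i (\<lambda>x. f x * g x) = (\<lambda>x. f x * pd i g x + pd i f x * g x)"
    by (auto simp: pd_mult f g)
  have "(LINT x|lborel. f x * pd i g x + pd i f x * g x) = 0"
    unfolding e[symmetric]
    by (rule integral_pd_eq_0[OF differentiable_on_UNIV_mult[OF f g] _ C(1)])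
      (auto simp: e C(2) intro!: continuous_intros fc gc pf pg)
  moreover have "integrable lborel (\<lambda>x. f x * pd i g x)" "integrable lborel (\<lambda>x. pd i f x * g x)"
    by (rule continuous_compact_support(1)[OF _ C(1)];
        auto simp: C(2) p0 intro!: continuous_intros fc gc pf pg)+
  ultimately show ?thesis by simp
qed

text \<open>The statement lives on the completed measure restricted to the domain, while
  translations, iterated integrals and the fundamental theorem of calculus are used for
  \<open>lborel\<close>. For Borel functions vanishing off \<open>S\<close> the two agree.\<close>

lemma lebesgue_on_eq_lborel:
  fixes f :: "R3 \<Rightarrow> 'b::euclidean_space"
  assumes "S \<in> sets lebesgue" "f \<in> borel_measurable borel" "\<And>x. x \<notin> S \<Longrightarrow> f x = 0"
  shows "integral\<^sup>L (lebesgue_on S) f = integral\<^sup>L lborel f"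
    "integrable (lebesgue_on S) f \<longleftrightarrow> integrable lborel f"
    "f \<in> borel_measurable (lebesgue_on S)"
proof -
  have e: "(\<lambda>x. indicator S x *\<^sub>R f x) = f"
    using assms(3) by (auto simp: indicator_def)
  have m: "f \<in> borel_measurable lborel" using assms(2) by simp
  show "integral\<^sup>L (lebesgue_on S) f = integral\<^sup>L lborel f"
    using assms(1) integral_completion[OF m] by (subst integral_restrict_space) (auto simp: e)
  show "integrable (lebesgue_on S) f \<longleftrightarrow> integrable lborel f"
    using assms(1) integrable_completion[OF m] by (subst integrable_restrict_space) (auto simp: e)
  show "f \<in> borel_measurable (lebesgue_on S)"
    using assms(2) by (intro measurable_restrict_space1 measurable_completion) simp
qed

section \<open>The Loomis-Whitney inequality\<close>

text \<open>A square root that sends infinity to infinity, so that the inequalities below need no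
  finiteness assumptions.\<close>

definition esqrt :: "ennreal \<Rightarrow> ennreal" where
  "esqrt a = (if a = \<infinity> then \<infinity> else ennreal (sqrt (enn2real a)))"

lemma esqrt_measurable [measurable]: "esqrt \<in> borel_measurable borel"
  unfolding esqrt_def[abs_def] by measurable

lemma esqrt_sq: "(esqrt a)\<^sup>2 = a"
  by (cases a) (auto simp: esqrt_def ennreal_power)

lemma esqrt_ennreal: "x \<ge> 0 \<Longrightarrow> esqrt (ennreal x) = ennreal (sqrt x)"
  by (simp add: esqrt_def)

lemma esqrt_mono: "a \<le> b \<Longrightarrow> esqrt a \<le> esqrt b"
  by (cases a; cases b) (auto simp: esqrt_def top_unique)

lemma ennreal_sq_le_imp_le: "a\<^sup>2 \<le> b\<^sup>2 \<Longrightarrow> a \<le> (b::ennreal)"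
  by (cases a; cases b) (auto simp: ennreal_power top_unique abs_le_square_iff[symmetric])

lemma nn_integral_Cauchy_Schwarz_esqrt:
  assumes [measurable]: "f \<in> borel_measurable M" "g \<in> borel_measurable M"
  shows "(\<integral>\<^sup>+x. esqrt (f x) * esqrt (g x) \<partial>M) \<le> esqrt (\<integral>\<^sup>+x. f x \<partial>M) * esqrt (\<integral>\<^sup>+x. g x \<partial>M)"
proof (rule ennreal_sq_le_imp_le)
  have "(\<integral>\<^sup>+x. esqrt (f x) * esqrt (g x) \<partial>M)\<^sup>2 \<le> (\<integral>\<^sup>+x. (esqrt (f x))\<^sup>2 \<partial>M) * (\<integral>\<^sup>+x. (esqrt (g x))\<^sup>2 \<partial>M)"
    by (rule Cauchy_Schwarz_nn_integral; measurable)
  then show "(\<integral>\<^sup>+x. esqrt (f x) * esqrt (g x) \<partial>M)\<^sup>2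
      \<le> (esqrt (\<integral>\<^sup>+x. f x \<partial>M) * esqrt (\<integral>\<^sup>+x. g x \<partial>M))\<^sup>2"
    by (simp add: power_mult_distrib esqrt_sq)
qed

text \<open>Each factor is constant in one variable, so Cauchy-Schwarz applies once per variable to
  the other two: in \<open>z\<close> to \<open>q\<close> and \<open>s\<close>, then in
  \<open>y\<close> to \<open>p\<close> and the integrated \<open>s\<close>, then in \<open>x\<close>
  to the integrated \<open>p\<close> and \<open>q\<close>.\<close>

lemma Loomis_Whitney:
  fixes P Q S :: "real \<times> real \<times> real \<Rightarrow> ennreal"
  assumes [measurable]: "P \<in> borel_measurable borel" "Q \<in> borel_measurable borel" "S \<in> borel_measurable borel"
  shows "(\<integral>\<^sup>+x. \<integral>\<^sup>+y. \<integral>\<^sup>+z. esqrt (\<integral>\<^sup>+t. P (x, y, t) \<partial>lborel) * esqrt (\<integral>\<^sup>+t. Q (x, t, z) \<partial>lborel)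
              * esqrt (\<integral>\<^sup>+t. S (t, y, z) \<partial>lborel) \<partial>lborel \<partial>lborel \<partial>lborel)
       \<le> esqrt (\<integral>\<^sup>+x. \<integral>\<^sup>+y. \<integral>\<^sup>+z. P (x, y, z) \<partial>lborel \<partial>lborel \<partial>lborel)
        * esqrt (\<integral>\<^sup>+x. \<integral>\<^sup>+y. \<integral>\<^sup>+z. Q (x, y, z) \<partial>lborel \<partial>lborel \<partial>lborel)
        * esqrt (\<integral>\<^sup>+x. \<integral>\<^sup>+y. \<integral>\<^sup>+z. S (x, y, z) \<partial>lborel \<partial>lborel \<partial>lborel)"
proof -
  have [measurable]: "P \<in> borel_measurable (borel \<Otimes>\<^sub>M (borel \<Otimes>\<^sub>M borel))"
    "Q \<in> borel_measurable (borel \<Otimes>\<^sub>M (borel \<Otimes>\<^sub>M borel))" "S \<in> borel_measurable (borel \<Otimes>\<^sub>M (borel \<Otimes>\<^sub>M borel))"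
    using assms by (simp_all add: borel_prod)
  define p where "p x y = (\<integral>\<^sup>+t. P (x, y, t) \<partial>lborel)" for x y
  define q where "q x z = (\<integral>\<^sup>+t. Q (x, t, z) \<partial>lborel)" for x z
  define s where "s y z = (\<integral>\<^sup>+t. S (t, y, z) \<partial>lborel)" for y z
  have [measurable]: "case_prod p \<in> borel_measurable (borel \<Otimes>\<^sub>M borel)"
    "case_prod q \<in> borel_measurable (borel \<Otimes>\<^sub>M borel)" "case_prod s \<in> borel_measurable (borel \<Otimes>\<^sub>M borel)"
    unfolding p_def[abs_def] q_def[abs_def] s_def[abs_def] by measurable
  let ?s = "\<integral>\<^sup>+y. \<integral>\<^sup>+z. s y z \<partial>lborel \<partial>lborel"
  have z: "(\<integral>\<^sup>+z. esqrt (p x y) * esqrt (q x z) * esqrt (s y z) \<partial>lborel)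
     \<le> esqrt (p x y) * (esqrt (\<integral>\<^sup>+z. q x z \<partial>lborel) * esqrt (\<integral>\<^sup>+z. s y z \<partial>lborel))" for x y
    by (simp add: mult.assoc nn_integral_cmult mult_left_mono nn_integral_Cauchy_Schwarz_esqrt)
  have y: "(\<integral>\<^sup>+y. esqrt (p x y) * (esqrt (\<integral>\<^sup>+z. q x z \<partial>lborel) * esqrt (\<integral>\<^sup>+z. s y z \<partial>lborel)) \<partial>lborel)
     \<le> (esqrt (\<integral>\<^sup>+y. p x y \<partial>lborel) * esqrt (\<integral>\<^sup>+z. q x z \<partial>lborel)) * esqrt ?s" for x
  proof -
    have "(\<integral>\<^sup>+y. esqrt (p x y) * (esqrt (\<integral>\<^sup>+z. q x z \<partial>lborel) * esqrt (\<integral>\<^sup>+z. s y z \<partial>lborel)) \<partial>lborel)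
       = esqrt (\<integral>\<^sup>+z. q x z \<partial>lborel) * (\<integral>\<^sup>+y. esqrt (p x y) * esqrt (\<integral>\<^sup>+z. s y z \<partial>lborel) \<partial>lborel)"
      by (subst nn_integral_cmult[symmetric]) (auto simp: mult_ac)
    also have "\<dots> \<le> esqrt (\<integral>\<^sup>+z. q x z \<partial>lborel) * (esqrt (\<integral>\<^sup>+y. p x y \<partial>lborel) * esqrt ?s)"
      by (intro mult_left_mono nn_integral_Cauchy_Schwarz_esqrt) auto
    finally show ?thesis by (simp add: mult_ac)
  qed
  have x: "(\<integral>\<^sup>+x. (esqrt (\<integral>\<^sup>+y. p x y \<partial>lborel) * esqrt (\<integral>\<^sup>+z. q x z \<partial>lborel)) * esqrt ?s \<partial>lborel)
     \<le> (esqrt (\<integral>\<^sup>+x. \<integral>\<^sup>+y. p x y \<partial>lborel \<partial>lborel) * esqrt (\<integral>\<^sup>+x. \<integral>\<^sup>+z. q x z \<partial>lborel \<partial>lborel)) * esqrt ?s"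
    by (subst nn_integral_multc) (auto intro!: mult_right_mono nn_integral_Cauchy_Schwarz_esqrt)
  have "(\<integral>\<^sup>+x. \<integral>\<^sup>+y. \<integral>\<^sup>+z. esqrt (p x y) * esqrt (q x z) * esqrt (s y z) \<partial>lborel \<partial>lborel \<partial>lborel)
     \<le> (esqrt (\<integral>\<^sup>+x. \<integral>\<^sup>+y. p x y \<partial>lborel \<partial>lborel) * esqrt (\<integral>\<^sup>+x. \<integral>\<^sup>+z. q x z \<partial>lborel \<partial>lborel)) * esqrt ?s"
    by (intro order_trans[OF nn_integral_mono x] order_trans[OF nn_integral_mono y] z)
  \<comment> \<open>In \<open>q\<close> the second variable and in \<open>s\<close> the first was
    integrated innermost; Tonelli restores the order \<open>x, y, z\<close>.\<close>
  also have "(\<integral>\<^sup>+x. \<integral>\<^sup>+z. q x z \<partial>lborel \<partial>lborel) = (\<integral>\<^sup>+x. \<integral>\<^sup>+y. \<integral>\<^sup>+z. Q (x, y, z) \<partial>lborel \<partial>lborel \<partial>lborel)"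
    unfolding q_def by (intro nn_integral_cong lborel_pair.Fubini') measurable
  also have "?s = (\<integral>\<^sup>+y. \<integral>\<^sup>+x. \<integral>\<^sup>+z. S (x, y, z) \<partial>lborel \<partial>lborel \<partial>lborel)"
    unfolding s_def by (intro nn_integral_cong lborel_pair.Fubini') measurable
  also have "\<dots> = (\<integral>\<^sup>+x. \<integral>\<^sup>+y. \<integral>\<^sup>+z. S (x, y, z) \<partial>lborel \<partial>lborel \<partial>lborel)"
    by (intro lborel_pair.Fubini') measurable
  finally show ?thesis
    unfolding p_def q_def s_def .
qed

section \<open>Lebesgue measure on \<open>R3\<close> as an iterated integral, and the
  one-dimensional bound\<close>

definition R3_of :: "real \<times> real \<times> real \<Rightarrow> R3" where
  "R3_of v = (\<chi> i. if i = 1 then fst v else if i = 2 then fst (snd v) else snd (snd v))"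

lemma R3_of_nth [simp]: "R3_of (x, y, z) $ 1 = x" "R3_of (x, y, z) $ 2 = y" "R3_of (x, y, z) $ 3 = z"
  by (simp_all add: R3_of_def)

lemma R3_of_measurable [measurable]: "R3_of \<in> borel_measurable borel"
proof (rule borel_measurable_continuous_onI)
  show "continuous_on UNIV R3_of"
    unfolding R3_of_def[abs_def]
  proof (rule continuous_on_vec_lambda)
    fix i :: 3
    show "continuous_on UNIV (\<lambda>v::real \<times> real \<times> real. if i = 1 then fst v else if i = 2 then fst (snd v) else snd (snd v))"
      by (cases "i = 1"; cases "i = 2") (auto intro!: continuous_intros)
  qed
qed

text \<open>Lebesgue measure is determined by the volumes of boxes, and the preimage of a box under
  \<open>R3_of\<close> is a product of three intervals.\<close>

lemma lborel_R3: "(lborel :: R3 measure) = distr lborel borel R3_of"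
proof (rule lborel_eqI)
  fix l u :: R3 assume le: "\<And>b. b \<in> Basis \<Longrightarrow> l \<bullet> b \<le> u \<bullet> b"
  have le': "l $ i \<le> u $ i" for i
    using le[of "axis i 1"] by (simp add: inner_axis axis_in_Basis_iff)
  have all3: "(\<forall>i::3. Q i) \<longleftrightarrow> Q 1 \<and> Q 2 \<and> Q 3" for Q using forall_3 by blast
  have "R3_of -` box l u = box (l $ 1) (u $ 1) \<times> (box (l $ 2) (u $ 2) \<times> box (l $ 3) (u $ 3))"
    by (auto simp: mem_box_R3 all3)
  then have "emeasure (distr lborel borel R3_of) (box l u)
      = emeasure (lborel \<Otimes>\<^sub>M (lborel \<Otimes>\<^sub>M lborel)) (box (l $ 1) (u $ 1) \<times> (box (l $ 2) (u $ 2) \<times> box (l $ 3) (u $ 3)))"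
    by (subst emeasure_distr) (auto simp: lborel_prod)
  also have "\<dots> = ennreal ((u $ 1 - l $ 1) * ((u $ 2 - l $ 2) * (u $ 3 - l $ 3)))"
    using le' by (simp add: lborel.emeasure_pair_measure_Times lborel_pair.emeasure_pair_measure_Times
        sigma_finite_measure.emeasure_pair_measure_Times[OF lborel_pair.sigma_finite] ennreal_mult)
  also have "(u $ 1 - l $ 1) * ((u $ 2 - l $ 2) * (u $ 3 - l $ 3)) = (\<Prod>i\<in>UNIV. u $ i - l $ i)"
    unfolding UNIV_3 by (simp add: mult.assoc)
  also have "\<dots> = (\<Prod>b\<in>Basis. (u - l) \<bullet> b)"
  proof -
    have B: "(Basis :: R3 set) = range (\<lambda>i. axis i 1)"
      by (auto simp: Basis_vec_def)
    show ?thesis unfolding B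
      by (subst prod.reindex) (auto simp: inj_on_def axis_eq_axis inner_axis)
  qed
  finally show "emeasure (distr lborel borel R3_of) (box l u) = (\<Prod>b\<in>Basis. (u - l) \<bullet> b)" .
qed simp

lemma nn_integral_R3:
  assumes [measurable]: "F \<in> borel_measurable borel"
  shows "(\<integral>\<^sup>+v. F v \<partial>lborel) = (\<integral>\<^sup>+x. \<integral>\<^sup>+y. \<integral>\<^sup>+z. F (R3_of (x, y, z)) \<partial>lborel \<partial>lborel \<partial>lborel)"
proof -
  have [measurable]: "R3_of \<in> borel_measurable (borel \<Otimes>\<^sub>M (borel \<Otimes>\<^sub>M borel))"
    using R3_of_measurable by (simp add: borel_prod)
  have "(\<integral>\<^sup>+v. F v \<partial>lborel) = (\<integral>\<^sup>+v. F (R3_of v) \<partial>(lborel \<Otimes>\<^sub>M lborel))"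
    unfolding lborel_prod by (subst lborel_R3, rule nn_integral_distr) auto
  also have "\<dots> = (\<integral>\<^sup>+x. \<integral>\<^sup>+w. F (R3_of (x, w)) \<partial>lborel \<partial>lborel)"
    by (rule lborel.nn_integral_fst[symmetric]) (simp add: lborel_prod)
  also have "\<dots> = (\<integral>\<^sup>+x. \<integral>\<^sup>+w. F (R3_of (x, w)) \<partial>(lborel \<Otimes>\<^sub>M lborel) \<partial>lborel)"
    by (simp add: lborel_prod)
  also have "\<dots> = (\<integral>\<^sup>+x. \<integral>\<^sup>+y. \<integral>\<^sup>+z. F (R3_of (x, y, z)) \<partial>lborel \<partial>lborel \<partial>lborel)"
    by (intro nn_integral_cong lborel.nn_integral_fst[symmetric]) measurable
  finally show ?thesis .
qed

lemma compact_support_le_nn_integral_deriv: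
  fixes q q' :: "real \<Rightarrow> real"
  assumes d: "\<And>t. (q has_real_derivative q' t) (at t)" and c: "continuous_on UNIV q'"
    and R: "\<And>t. \<bar>t\<bar> > R \<Longrightarrow> q t = 0"
  shows "ennreal \<bar>q s\<bar> \<le> (\<integral>\<^sup>+t. ennreal \<bar>q' t\<bar> \<partial>lborel)"
proof -
  \<comment> \<open>Here \<open>\<bar>a\<bar> \<ge> \<bar>R\<bar> + 1 > R\<close>, so
    \<open>q\<close> vanishes at \<open>a\<close> and the fundamental theorem on
    \<open>{a .. s}\<close> returns \<open>q s\<close> itself.\<close>
  define a where "a = min s (- \<bar>R\<bar> - 1)"
  have a: "a \<le> s" "q a = 0" by (auto simp: a_def intro!: R)
  have h: "has_bochner_integral lborel (\<lambda>x. indicator {a .. s} x *\<^sub>R q' x) (q s - q a)"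
    using d c a(1) by (intro has_bochner_integral_FTC_Icc)
      (auto simp: has_real_derivative_iff_has_vector_derivative[symmetric] intro: continuous_on_subset has_field_derivative_at_within)
  have "ennreal \<bar>q s\<bar> = ennreal (norm (LINT x|lborel. indicator {a .. s} x *\<^sub>R q' x))"
    using has_bochner_integral_integral_eq[OF h] a(2) by simp
  also have "\<dots> \<le> (\<integral>\<^sup>+x. ennreal (norm (indicator {a .. s} x *\<^sub>R q' x)) \<partial>lborel)"
    using h by (intro integral_norm_bound_ennreal) (auto simp: has_bochner_integral_iff)
  also have "\<dots> \<le> (\<integral>\<^sup>+t. ennreal \<bar>q' t\<bar> \<partial>lborel)"
    by (intro nn_integral_mono ennreal_leI) (auto simp: indicator_def)
  finally show ?thesis .
qed

section \<open>Poincare inequality and fundamental lemma\<close>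

lemma subset_Pow_UNIV: "S \<subseteq> Pow UNIV"
  by simp

text \<open>Boxes are an intersection-stable generator of the Borel sets, and the sets over which
  \<open>g\<close> integrates to 0 form a Dynkin system. The whole space is not a box, so its
  integral is a separate premise, used for complements.\<close>

lemma AE_zero_if_box_integrals_zero:
  fixes g :: "'a::euclidean_space \<Rightarrow> real"
  assumes g: "integrable lborel g"
    and b: "\<And>a b. (LINT x|lborel. indicator (box a b) x * g x) = 0"
    and t: "(LINT x|lborel. g x) = 0"
  shows "AE x in lborel. g x = 0"
proof -
  have si: "integrable lborel (\<lambda>x. indicator A x * g x)" if "A \<in> sets borel" for A
    using integrable_mult_indicator[of A lborel g] that g by simp
  have "(LINT x|lborel. indicator A x * g x) = 0" if A: "A \<in> sets borel" for A
  proof -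
    have "Int_stable (range (\<lambda>(a, b). box a b :: 'a set))"
      by (auto simp: Int_stable_def box_Int_box)
    moreover have "A \<in> sigma_sets UNIV (range (\<lambda>(a, b). box a b :: 'a set))"
      using A by (simp add: borel_eq_box)
    ultimately show ?thesis
    proof (induction A rule: sigma_sets_induct_disjoint[OF _ subset_Pow_UNIV, consumes 2, case_names basic empty compl union])
      case (basic A)
      then show ?case using b by auto
    next
      case (compl A)
      then have "A \<in> sets borel" by (simp add: borel_eq_box)
      moreover have "indicator (UNIV - A) x * g x = g x - indicator A x * g x" for x
        by (simp add: indicator_def)
      ultimately show ?case
        using compl(2) t g si by simp
    next
      case (union A)
      then have m: "A i \<in> sets borel" for i by (auto simp: borel_eq_box)
      have "(LINT x:(\<Union>i. A i)|lborel. g x) = (\<Sum>i. (LINT x:(A i)|lborel. g x))"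
        using m union(1) si[of "\<Union>i. A i"]
        by (intro lebesgue_integral_countable_add) (auto simp: disjoint_family_on_def set_integrable_def)
      then show ?case
        using union(3) by (simp add: set_lebesgue_integral_def)
    qed auto
  qed
  then show ?thesis
    using density_unique_real[OF g, of "\<lambda>_. 0"] by (simp add: set_lebesgue_integral_def)
qed

locale bounded_open_set =
  fixes \<Omega> :: "R3 set"
  assumes open_dom: "open \<Omega>" and bounded_dom: "bounded \<Omega>"
begin

abbreviation "M \<equiv> lebesgue_on \<Omega>"

lemma dom_sets [measurable]: "\<Omega> \<in> sets lebesgue"
  using open_dom by (simp add: sets_completionI_sets)

sublocale finite_measure M
  using open_dom bounded_dom
  by (intro finite_measure_lebesgue_on bounded_set_imp_lmeasurable) auto

lemma test_fun_continuous: "test_fun \<Omega> f \<Longrightarrow> continuous_on UNIV f"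
  by (auto simp: test_fun_def intro: differentiable_imp_continuous_on smooth_on_differentiable)

lemma test_fun_differentiable: "test_fun \<Omega> f \<Longrightarrow> f differentiable_on UNIV"
  by (auto simp: test_fun_def intro: smooth_on_differentiable)

lemma test_fun_continuous_pd: "test_fun \<Omega> f \<Longrightarrow> continuous_on UNIV (pd i f)"
  by (auto simp: test_fun_def intro: smooth_on_continuous_pd)

lemma test_fun_continuous_grad: "test_fun \<Omega> f \<Longrightarrow> continuous_on UNIV (grad f)"
  unfolding grad_def[abs_def] by (intro continuous_on_vec_lambda test_fun_continuous_pd)

lemma test_fun_support:
  assumes "test_fun \<Omega> f"
  obtains C where "compact C" "C \<subseteq> \<Omega>" "\<And>x. x \<notin> C \<Longrightarrow> f x = 0" "\<And>x i. x \<notin> C \<Longrightarrow> pd i f x = 0"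
    "\<And>x. x \<notin> C \<Longrightarrow> grad f x = 0"
proof -
  from assms obtain C where C: "compact C" "C \<subseteq> \<Omega>" "\<And>x. x \<notin> C \<Longrightarrow> f x = 0"
    by (auto simp: test_fun_iff)
  moreover have "pd i f x = 0" if "x \<notin> C" for x i
    using pd_outside[OF compact_imp_closed[OF C(1)] C(3) that] .
  ultimately show ?thesis
    using that[of C] by (simp add: grad_def vec_eq_iff)
qed

lemma compactly_supported_L2:
  fixes f :: "R3 \<Rightarrow> 'b::euclidean_space"
  assumes "continuous_on UNIV f" "compact C" "\<And>x. x \<notin> C \<Longrightarrow> f x = 0"
  shows "L2 M f"
proof -
  obtain B where "\<forall>x. norm (f x) \<le> B"
    using continuous_compact_support(2)[OF assms] by blast
  moreover have "f \<in> borel_measurable borel"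
    by (rule borel_measurable_continuous_onI[OF assms(1)])
  then have "f \<in> borel_measurable M"
    by (intro measurable_restrict_space1 measurable_completion) simp
  ultimately show ?thesis by (intro L2_bounded[of _ B]) auto
qed

lemma L2_test_fun: "test_fun \<Omega> f \<Longrightarrow> L2 M f"
  by (rule test_fun_support, assumption, rule compactly_supported_L2[OF test_fun_continuous])

lemma L2_pd_test_fun: "test_fun \<Omega> f \<Longrightarrow> L2 M (pd i f)"
  by (rule test_fun_support, assumption, rule compactly_supported_L2[OF test_fun_continuous_pd])

lemma L2_grad_test_fun: "test_fun \<Omega> f \<Longrightarrow> L2 M (grad f)"
  by (rule test_fun_support, assumption, rule compactly_supported_L2[OF test_fun_continuous_grad])

lemma grad_lin:
  assumes "test_fun \<Omega> f" "test_fun \<Omega> g"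
  shows "grad (\<lambda>x. a * f x + b * g x) = (\<lambda>x. a *\<^sub>R grad f x + b *\<^sub>R grad g x)"
  by (simp add: fun_eq_iff vec_eq_iff pd_lin test_fun_differentiable[OF assms(1)] test_fun_differentiable[OF assms(2)])

lemma grad_diff:
  assumes "test_fun \<Omega> f" "test_fun \<Omega> g"
  shows "grad (\<lambda>x. f x - g x) = (\<lambda>x. grad f x - grad g x)"
  using grad_lin[OF assms, of 1 "-1"] by simp

lemma test_fun_diff: "test_fun \<Omega> f \<Longrightarrow> test_fun \<Omega> g \<Longrightarrow> test_fun \<Omega> (\<lambda>x. f x - g x)"
  using test_fun_lin[of \<Omega> f g 1 "-1"] by simp

lemma test_fun_by_parts:
  assumes f: "test_fun \<Omega> f" and g: "test_fun \<Omega> g"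
  shows "(LINT x|M. f x * pd i g x) = - (LINT x|M. pd i f x * g x)"
proof -
  obtain C where C: "compact C" "C \<subseteq> \<Omega>" "\<And>x. x \<notin> C \<Longrightarrow> f x = 0" "\<And>x i. x \<notin> C \<Longrightarrow> pd i f x = 0"
    using test_fun_support[OF f] by metis
  have "(\<lambda>x. f x * pd i g x) \<in> borel_measurable borel" "(\<lambda>x. pd i f x * g x) \<in> borel_measurable borel"
    by (intro borel_measurable_continuous_onI continuous_intros test_fun_continuous test_fun_continuous_pd f g)+
  then have "(LINT x|M. f x * pd i g x) = (LINT x|lborel. f x * pd i g x)"
    "(LINT x|M. pd i f x * g x) = (LINT x|lborel. pd i f x * g x)"
    using C by (intro lebesgue_on_eq_lborel; auto)+
  then show ?thesis
    using integration_by_parts[OF test_fun_differentiable[OF f] test_fun_continuous_pd[OF f] C(1,3)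
        test_fun_differentiable[OF g] test_fun_continuous_pd[OF g]] by simp
qed

text \<open>Integrate \<open>f\<^sup>2 = f\<^sup>2 \<partial>\<^sub>i x\<^sub>i\<close> by parts and use that \<open>x\<^sub>i\<close> is bounded on \<open>\<Omega>\<close>.\<close>

lemma Poincare_test_fun:
  obtains R where "R \<ge> 0" "\<And>f i. test_fun \<Omega> f \<Longrightarrow> L2norm M f \<le> R * L2norm M (pd i f)"
proof -
  obtain r where r: "r \<ge> 0" "\<And>x. x \<in> \<Omega> \<Longrightarrow> norm x \<le> r"
    using bounded_dom by (metis bounded_pos less_imp_le)
  show ?thesis
  \<comment> \<open>The 2 comes from differentiating \<open>f\<^sup>2\<close>, and \<open>r\<close>
    bounds \<open>x $ i\<close> on the domain.\<close>
  proof (rule that[of "2 * r"])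
    fix f i assume f: "test_fun \<Omega> f"
    note fd = test_fun_differentiable[OF f] and fc = test_fun_continuous[OF f]
      and pc = test_fun_continuous_pd[OF f, of i]
    obtain C where C: "compact C" "C \<subseteq> \<Omega>" "\<And>x. x \<notin> C \<Longrightarrow> f x = 0" "\<And>x i. x \<notin> C \<Longrightarrow> pd i f x = 0"
      using test_fun_support[OF f] by metis
    have pf2: "pd i (\<lambda>x. f x * f x) = (\<lambda>x. 2 * f x * pd i f x)"
      by (auto simp: pd_mult fd)
    have cd: "((\<lambda>x::R3. x $ i) has_derivative (\<lambda>h. h $ i)) (at x)" for x
      by (rule bounded_linear_imp_has_derivative[OF bounded_linear_vec_nth])
    then have cdi: "(\<lambda>x::R3. x $ i) differentiable_on UNIV"
      by (auto simp: differentiable_on_def differentiable_def)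
    have pdc: "pd i (\<lambda>x. x $ i) = (\<lambda>x. 1)"
      unfolding pd_def frechet_derivative_at[OF cd, symmetric] by simp
    have ibp: "(LINT x|lborel. (f x * f x) * 1) = - (LINT x|lborel. (2 * f x * pd i f x) * x $ i)"
      using integration_by_parts[OF differentiable_on_UNIV_mult[OF fd fd], of i C "\<lambda>x. x $ i"]
      unfolding pf2 pdc using C cdi by (simp add: continuous_intros fc pc)
    have "(LINT x|M. (f x * f x) * 1) = (LINT x|lborel. (f x * f x) * 1)"
      using C by (intro lebesgue_on_eq_lborel borel_measurable_continuous_onI continuous_intros fc) auto
    moreover have "(LINT x|M. (2 * f x * pd i f x) * x $ i) = (LINT x|lborel. (2 * f x * pd i f x) * x $ i)"
      using C by (intro lebesgue_on_eq_lborel borel_measurable_continuous_onI continuous_intros fc pc) auto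
    ultimately have "(L2norm M f)\<^sup>2 = - (LINT x|M. (2 * f x * pd i f x) * x $ i)"
      using ibp unfolding L2norm_sq by (simp add: power2_eq_square)
    also have "\<dots> \<le> (LINT x|M. \<bar>(2 * f x * pd i f x) * x $ i\<bar>)"
      by (rule order_trans[OF abs_ge_minus_self integral_abs_bound])
    also have "\<dots> \<le> (LINT x|M. (2 * r) * (norm (f x) * norm (pd i f x)))"
    proof (rule integral_mono')
      show "integrable M (\<lambda>x. (2 * r) * (norm (f x) * norm (pd i f x)))"
        by (intro integrable_mult_right L2_norm_mult_integrable L2_test_fun L2_pd_test_fun f)
      fix x assume "x \<in> space M"
      then have "\<bar>x $ i\<bar> \<le> r" using r(2) component_le_norm_cart order_trans by fastforce
      then have "\<bar>x $ i\<bar> * \<bar>2 * f x * pd i f x\<bar> \<le> r * \<bar>2 * f x * pd i f x\<bar>"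
        by (rule mult_right_mono) simp
      then show "\<bar>(2 * f x * pd i f x) * x $ i\<bar> \<le> (2 * r) * (norm (f x) * norm (pd i f x))"
        by (simp add: abs_mult mult_ac)
    qed (use r(1) in simp)
    also have "\<dots> \<le> (2 * r) * (L2norm M f * L2norm M (pd i f))"
    proof -
      have "L2 M (\<lambda>x. norm (f x))" "L2 M (\<lambda>x. norm (pd i f x))"
        using L2_test_fun[OF f] L2_pd_test_fun[OF f, of i] by (auto simp: L2_def)
      from L2_Cauchy_Schwarz[OF this]
      have "(LINT x|M. norm (f x) * norm (pd i f x)) \<le> L2norm M f * L2norm M (pd i f)"
        by (simp add: L2norm_def)
      then show ?thesis using r(1) by (simp add: mult_left_mono)
    qed
    finally have *: "L2norm M f * L2norm M f \<le> L2norm M f * (2 * r * L2norm M (pd i f))"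
      by (simp add: power2_eq_square mult_ac)
    show "L2norm M f \<le> 2 * r * L2norm M (pd i f)"
    proof (cases "L2norm M f = 0")
      case True
      then show ?thesis using r(1) by (simp add: L2norm_nonneg)
    next
      case False
      then have "L2norm M f > 0" using L2norm_nonneg[of M f] by simp
      with * show ?thesis by (rule mult_left_le_imp_le)
    qed
  qed (use r in simp)
qed

text \<open>Test with the bumps of the box: they tend to its indicator and are bounded by 1, so
  \<open>\<bar>g\<bar>\<close> dominates.\<close>

lemma box_integral_zero:
  assumes g: "L2 M g" and z: "\<And>f. test_fun \<Omega> f \<Longrightarrow> (LINT x|M. g x * f x) = 0"
    and ab: "cbox a b \<subseteq> \<Omega>"
  shows "(LINT x|M. indicator (box a b) x * g x) = 0"
proof -
  note [measurable] = L2_measurable[OF g]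
  have bm[measurable]: "bump a b n \<in> borel_measurable M" for n
    by (intro L2_measurable L2_test_fun test_fun_bump ab)
  have [measurable]: "indicat_real (box a b) \<in> borel_measurable M"
    by (intro measurable_restrict_space1 borel_measurable_indicator) (simp add: sets_completionI_sets)
  have "(\<lambda>n. LINT x|M. g x * bump a b n x) \<longlonglongrightarrow> (LINT x|M. g x * indicator (box a b) x)"
  proof (rule integral_dominated_convergence)
    show "integrable M (\<lambda>x. norm (g x))" by (intro integrable_norm L2_integrable g)
    show "(\<lambda>x. g x * indicator (box a b) x) \<in> borel_measurable M"
      by measurable
    show "AE x in M. norm (g x * bump a b n x) \<le> norm (g x)" for n
      by (simp add: abs_mult mult_left_le bump_bounds abs_of_nonneg)
  qed (auto intro!: tendsto_intros bump_tendsto)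
  then show ?thesis
    by (simp add: z test_fun_bump ab LIMSEQ_const_iff mult.commute)
qed

text \<open>The claim is local. On a box whose closure lies in the domain, \<open>g\<close>
  integrates to 0 over all sub-boxes and therefore vanishes almost everywhere; countably many such
  boxes exhaust the domain.\<close>

lemma fundamental_lemma:
  assumes g: "L2 M g" and z: "\<And>f. test_fun \<Omega> f \<Longrightarrow> (LINT x|M. g x * f x) = 0"
  shows "AE x in M. g x = 0"
proof -
  have box0: "AE x in M. x \<in> box a b \<longrightarrow> g x = 0" if ab: "cbox a b \<subseteq> \<Omega>" for a b
  proof -
    have sub: "box a b \<subseteq> \<Omega>" using ab box_subset_cbox by blast
    \<comment> \<open>Cutting off extends \<open>g\<close> by zero to the whole space, where
      arbitrary boxes may be integrated over.\<close>
    define g0 where "g0 x = indicator (box a b) x * g x" for x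
    have i: "integrable lebesgue (\<lambda>x. indicator \<Omega> x *\<^sub>R g x)"
      using L2_integrable[OF g] by (subst (asm) integrable_restrict_space) auto
    have "integrable lebesgue (\<lambda>x. indicator (box a b) x *\<^sub>R (indicator \<Omega> x *\<^sub>R g x))"
      by (rule integrable_mult_indicator[OF _ i]) (simp add: sets_completionI_sets)
    also have "(\<lambda>x. indicator (box a b) x *\<^sub>R (indicator \<Omega> x *\<^sub>R g x)) = g0"
      using sub by (auto simp: g0_def fun_eq_iff indicator_def)
    finally have g0i: "integrable lebesgue g0" .
    \<comment> \<open>\<open>g0\<close> is only Lebesgue measurable; a Borel version is needed to
      work over \<open>lborel\<close>.\<close>
    obtain g1 where g1: "g1 \<in> borel_measurable lborel" "AE x in lborel. g0 x = g1 x"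
      using completion_ex_borel_measurable_real[of g0 lborel] g0i by auto
    have ae: "AE x in lebesgue. g0 x = g1 x" using g1(2) by (rule AE_completion)
    have g1m: "g1 \<in> borel_measurable lebesgue" using g1(1) by (rule measurable_completion)
    have g1i: "integrable lborel g1"
      using g0i g1 integrable_cong_AE[OF _ g1m ae] integrable_completion[OF g1(1)] by auto
    \<comment> \<open>A box meets \<open>box a b\<close> in a box whose closed version stays in
      \<open>cbox a b\<close>, so \<open>box_integral_zero\<close> applies. The case
      \<open>UNIV\<close> supplies the total integral.\<close>
    have z0: "(LINT x|lborel. indicator B x * g1 x) = 0" if B: "B = UNIV \<or> (\<exists>c d. B = box c d)" for B
    proof -
      have Bs: "B \<in> sets borel" using B by auto
      obtain c d where cd: "box a b \<inter> B = box c d" "cbox a b \<supseteq> cbox c d \<or> box c d = {}"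
      proof (cases "B = UNIV")
        case False
        then obtain c' d' where "B = box c' d'" using B by auto
        then have 1: "box a b \<inter> B = box (\<Sum>i\<in>Basis. max (a\<bullet>i) (c'\<bullet>i) *\<^sub>R i) (\<Sum>i\<in>Basis. min (b\<bullet>i) (d'\<bullet>i) *\<^sub>R i)"
          by (simp add: box_Int_box)
        have "cbox (\<Sum>i\<in>Basis. max (a\<bullet>i) (c'\<bullet>i) *\<^sub>R i) (\<Sum>i\<in>Basis. min (b\<bullet>i) (d'\<bullet>i) *\<^sub>R i) = cbox a b \<inter> cbox c' d'"
          by (simp add: Int_interval)
        with 1 show ?thesis by (intro that) auto
      qed (use that[of a b] in auto)
      have "(LINT x|lborel. indicator B x * g1 x) = (LINT x|lebesgue. indicator B x * g1 x)"
        using g1(1) Bs by (intro integral_completion[symmetric] borel_measurable_times borel_measurable_indicator) auto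
      also have "\<dots> = (LINT x|lebesgue. indicator B x * g0 x)"
      proof (rule integral_cong_AE)
        have B': "B \<in> sets lebesgue" using Bs by auto
        show "(\<lambda>x. indicator B x * g1 x) \<in> borel_measurable lebesgue"
          "(\<lambda>x. indicator B x * g0 x) \<in> borel_measurable lebesgue"
          using g1m borel_measurable_integrable[OF g0i] B' by measurable
      qed (use ae in auto)
      also have "\<dots> = (LINT x|lebesgue. indicator \<Omega> x *\<^sub>R (indicator (box c d) x * g x))"
        unfolding cd(1)[symmetric] using sub
        by (intro Bochner_Integration.integral_cong) (auto simp: g0_def indicator_def)
      also have "\<dots> = (LINT x|M. indicator (box c d) x * g x)"
        by (subst integral_restrict_space) auto
      also have "\<dots> = 0"
        using cd(2)
      proof
        assume "cbox a b \<supseteq> cbox c d"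
        then show ?thesis using ab by (intro box_integral_zero g z) auto
      qed simp
      finally show ?thesis .
    qed
    have "AE x in lborel. g1 x = 0"
      by (rule AE_zero_if_box_integrals_zero[OF g1i]) (use z0 z0[of UNIV] in auto)
    then have "AE x in lebesgue. g0 x = 0"
      using g1(2) by (intro AE_completion) auto
    then have "AE x in M. g0 x = 0"
      by (subst AE_restrict_space_iff) auto
    then show ?thesis by (auto simp: g0_def elim!: eventually_mono)
  qed
  \<comment> \<open>By Lindelof countably many of these boxes suffice, so the union of the
    exceptional sets is still null.\<close>
  define F where "F = {box a b | a b. cbox a b \<subseteq> \<Omega>}"
  obtain F' where F': "F' \<subseteq> F" "countable F'" "\<Union>F' = \<Union>F"
    by (rule Lindelof[of F]) (auto simp: F_def)
  have "\<Omega> \<subseteq> \<Union>F"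
  proof
    fix x assume "x \<in> \<Omega>"
    then obtain e where e: "e > 0" "cball x e \<subseteq> \<Omega>"
      using open_dom open_contains_cball by blast
    obtain a b where ab: "x \<in> box a b" "box a b \<subseteq> ball x e"
      using rational_boxes[OF e(1), of x] by blast
    have "cbox a b = closure (box a b)" using ab(1) by (subst closure_box) auto
    also have "\<dots> \<subseteq> cball x e" using ab(2) by (meson ball_subset_cball closed_cball closure_minimal subset_trans)
    finally show "x \<in> \<Union>F" using ab(1) e(2) unfolding F_def by blast
  qed
  then have cov: "\<Omega> \<subseteq> \<Union>F'" using F'(3) by simp
  have "AE x in M. \<forall>B\<in>F'. x \<in> B \<longrightarrow> g x = 0"
    using F' box0 by (subst AE_ball_countable) (auto simp: F_def)
  then show ?thesis
    using AE_space
  proof eventually_elim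
    case (elim x)
    then show ?case using cov by auto
  qed
qed

section \<open>The trilinear estimate\<close>

text \<open>The one-dimensional bound is applied to \<open>f\<^sup>2\<close> rather than
  \<open>f\<close>: its derivative pairs \<open>f\<close> with a partial derivative, and such a
  product is controlled by L2 norms.\<close>

lemma test_fun_line_bound:
  assumes f: "test_fun \<Omega> f"
  shows "ennreal \<bar>f (v + s *\<^sub>R axis i 1)\<bar>
    \<le> esqrt (\<integral>\<^sup>+t. ennreal \<bar>2 * f (v + t *\<^sub>R axis i 1) * pd i f (v + t *\<^sub>R axis i 1)\<bar> \<partial>lborel)"
proof -
  obtain C where C: "compact C" "\<And>x. x \<notin> C \<Longrightarrow> f x = 0"
    using test_fun_support[OF f] by metis
  obtain r where r: "\<And>x. x \<in> C \<Longrightarrow> norm x \<le> r"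
    using compact_imp_bounded[OF C(1)] by (auto simp: bounded_iff)
  have out: "(f (v + t *\<^sub>R axis i 1))\<^sup>2 = 0" if "\<bar>t\<bar> > r + norm v" for t
  proof -
    have "\<bar>t\<bar> = norm (t *\<^sub>R axis i 1 :: R3)" by simp
    also have "\<dots> \<le> norm (v + t *\<^sub>R axis i 1) + norm v"
      by (metis add.commute add_diff_cancel_right' norm_triangle_ineq4)
    finally have "v + t *\<^sub>R axis i 1 \<notin> C" using r that by force
    then show ?thesis using C(2) by simp
  qed
  have "ennreal \<bar>(f (v + s *\<^sub>R axis i 1))\<^sup>2\<bar>
    \<le> (\<integral>\<^sup>+t. ennreal \<bar>2 * f (v + t *\<^sub>R axis i 1) * pd i f (v + t *\<^sub>R axis i 1)\<bar> \<partial>lborel)"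
  proof (rule compact_support_le_nn_integral_deriv[where R = "r + norm v"
        and q = "\<lambda>t. (f (v + t *\<^sub>R axis i 1))\<^sup>2" and s = s])
    show "((\<lambda>t. (f (v + t *\<^sub>R axis i 1))\<^sup>2) has_real_derivative
        2 * f (v + t *\<^sub>R axis i 1) * pd i f (v + t *\<^sub>R axis i 1)) (at t)" for t
      using DERIV_power[OF has_derivative_line[OF test_fun_differentiable[OF f], where x = v and i = i and t = t], of 2] by (simp add: mult_ac)
    show "continuous_on UNIV (\<lambda>t. 2 * f (v + t *\<^sub>R axis i 1) * pd i f (v + t *\<^sub>R axis i 1))"
      by (intro continuous_intros continuous_on_compose2[OF test_fun_continuous[OF f]]
          continuous_on_compose2[OF test_fun_continuous_pd[OF f]]) auto
  qed (rule out)
  from esqrt_mono[OF this] show ?thesis by (simp add: esqrt_ennreal)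
qed

lemma nn_integral_lebesgue_on_eq_lborel:
  fixes F :: "R3 \<Rightarrow> ennreal"
  assumes "F \<in> borel_measurable borel" "\<And>x. x \<notin> \<Omega> \<Longrightarrow> F x = 0"
  shows "(\<integral>\<^sup>+x. F x \<partial>M) = (\<integral>\<^sup>+x. F x \<partial>lborel)"
proof -
  have "(\<integral>\<^sup>+x. F x \<partial>M) = (\<integral>\<^sup>+x. F x * indicator \<Omega> x \<partial>lebesgue)"
    by (rule nn_integral_restrict_space) simp
  also have "\<dots> = (\<integral>\<^sup>+x. F x \<partial>lebesgue)"
    using assms(2) by (intro nn_integral_cong) (auto simp: indicator_def)
  finally show ?thesis by (simp add: nn_integral_completion)
qed

text \<open>The bounds for \<open>f\<close>, \<open>g\<close>, \<open>h\<close> integrate along axes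
  3, 2, 1, so each becomes independent of a different coordinate, which is the situation of
  \<open>Loomis_Whitney\<close>.\<close>

lemma test_fun_trilinear:
  assumes f: "test_fun \<Omega> f" and g: "test_fun \<Omega> g" and h: "test_fun \<Omega> h"
  shows "(\<integral>\<^sup>+x. ennreal \<bar>f x * g x * h x\<bar> \<partial>M)
    \<le> esqrt (\<integral>\<^sup>+x. ennreal \<bar>2 * f x * pd 3 f x\<bar> \<partial>M)
     * esqrt (\<integral>\<^sup>+x. ennreal \<bar>2 * g x * pd 2 g x\<bar> \<partial>M)
     * esqrt (\<integral>\<^sup>+x. ennreal \<bar>2 * h x * pd 1 h x\<bar> \<partial>M)"
proof -
  have out: "x \<notin> \<Omega> \<Longrightarrow> q x = 0" if "test_fun \<Omega> q" for q x
    using that by (auto simp: test_fun_iff)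
  note [measurable] = borel_measurable_continuous_onI[OF test_fun_continuous[OF f]]
    borel_measurable_continuous_onI[OF test_fun_continuous[OF g]]
    borel_measurable_continuous_onI[OF test_fun_continuous[OF h]]
    borel_measurable_continuous_onI[OF test_fun_continuous_pd[OF f]]
    borel_measurable_continuous_onI[OF test_fun_continuous_pd[OF g]]
    borel_measurable_continuous_onI[OF test_fun_continuous_pd[OF h]]
  define P where "P v = ennreal \<bar>2 * f (R3_of v) * pd 3 f (R3_of v)\<bar>" for v
  define Q where "Q v = ennreal \<bar>2 * g (R3_of v) * pd 2 g (R3_of v)\<bar>" for v
  define S where "S v = ennreal \<bar>2 * h (R3_of v) * pd 1 h (R3_of v)\<bar>" for v
  have m: "P \<in> borel_measurable borel" "Q \<in> borel_measurable borel" "S \<in> borel_measurable borel"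
    unfolding P_def[abs_def] Q_def[abs_def] S_def[abs_def] by measurable
  \<comment> \<open>The line through a point in direction \<open>i\<close> is based at that point
    with coordinate \<open>i\<close> set to 0, making visible that the line integral does not depend
    on it.\<close>
  have l: "R3_of (x, y, z) = R3_of (x, y, 0) + z *\<^sub>R axis 3 1"
    "R3_of (x, y, z) = R3_of (x, 0, z) + y *\<^sub>R axis 2 1"
    "R3_of (x, y, z) = R3_of (0, y, z) + x *\<^sub>R axis 1 1" for x y z
    by (simp_all add: R3_of_def vec_eq_iff forall_3 axis_def)
  have pw: "ennreal \<bar>f (R3_of (x, y, z)) * g (R3_of (x, y, z)) * h (R3_of (x, y, z))\<bar>
     \<le> esqrt (\<integral>\<^sup>+t. P (x, y, t) \<partial>lborel) * esqrt (\<integral>\<^sup>+t. Q (x, t, z) \<partial>lborel)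
              * esqrt (\<integral>\<^sup>+t. S (t, y, z) \<partial>lborel)" for x y z
  proof -
    have "ennreal \<bar>f (R3_of (x, y, z))\<bar> \<le> esqrt (\<integral>\<^sup>+t. P (x, y, t) \<partial>lborel)"
      using test_fun_line_bound[OF f, of "R3_of (x, y, 0)" z 3] by (simp only: P_def l(1)[symmetric])
    moreover have "ennreal \<bar>g (R3_of (x, y, z))\<bar> \<le> esqrt (\<integral>\<^sup>+t. Q (x, t, z) \<partial>lborel)"
      using test_fun_line_bound[OF g, of "R3_of (x, 0, z)" y 2] by (simp only: Q_def l(2)[symmetric])
    moreover have "ennreal \<bar>h (R3_of (x, y, z))\<bar> \<le> esqrt (\<integral>\<^sup>+t. S (t, y, z) \<partial>lborel)"
      using test_fun_line_bound[OF h, of "R3_of (0, y, z)" x 1] by (simp only: S_def l(3)[symmetric])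
    ultimately show ?thesis
      by (simp add: abs_mult ennreal_mult mult_mono)
  qed
  have "(\<integral>\<^sup>+x. ennreal \<bar>f x * g x * h x\<bar> \<partial>M) = (\<integral>\<^sup>+x. ennreal \<bar>f x * g x * h x\<bar> \<partial>lborel)"
    by (rule nn_integral_lebesgue_on_eq_lborel) (simp_all add: out[OF f])
  also have "\<dots> = (\<integral>\<^sup>+x. \<integral>\<^sup>+y. \<integral>\<^sup>+z. ennreal \<bar>f (R3_of (x, y, z)) * g (R3_of (x, y, z)) * h (R3_of (x, y, z))\<bar>
      \<partial>lborel \<partial>lborel \<partial>lborel)"
    by (rule nn_integral_R3) measurable
  also have "\<dots> \<le> (\<integral>\<^sup>+x. \<integral>\<^sup>+y. \<integral>\<^sup>+z. esqrt (\<integral>\<^sup>+t. P (x, y, t) \<partial>lborel) * esqrt (\<integral>\<^sup>+t. Q (x, t, z) \<partial>lborel)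
              * esqrt (\<integral>\<^sup>+t. S (t, y, z) \<partial>lborel) \<partial>lborel \<partial>lborel \<partial>lborel)"
    by (intro nn_integral_mono pw)
  also note Loomis_Whitney[OF m]
  also have "(\<integral>\<^sup>+x. \<integral>\<^sup>+y. \<integral>\<^sup>+z. P (x, y, z) \<partial>lborel \<partial>lborel \<partial>lborel) = (\<integral>\<^sup>+x. ennreal \<bar>2 * f x * pd 3 f x\<bar> \<partial>M)"
    unfolding P_def by (subst nn_integral_R3[symmetric], measurable,
        rule nn_integral_lebesgue_on_eq_lborel[symmetric]) (simp_all add: out[OF f])
  also have "(\<integral>\<^sup>+x. \<integral>\<^sup>+y. \<integral>\<^sup>+z. Q (x, y, z) \<partial>lborel \<partial>lborel \<partial>lborel) = (\<integral>\<^sup>+x. ennreal \<bar>2 * g x * pd 2 g x\<bar> \<partial>M)"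
    unfolding Q_def by (subst nn_integral_R3[symmetric], measurable,
        rule nn_integral_lebesgue_on_eq_lborel[symmetric]) (simp_all add: out[OF g])
  also have "(\<integral>\<^sup>+x. \<integral>\<^sup>+y. \<integral>\<^sup>+z. S (x, y, z) \<partial>lborel \<partial>lborel \<partial>lborel) = (\<integral>\<^sup>+x. ennreal \<bar>2 * h x * pd 1 h x\<bar> \<partial>M)"
    unfolding S_def by (subst nn_integral_R3[symmetric], measurable,
        rule nn_integral_lebesgue_on_eq_lborel[symmetric]) (simp_all add: out[OF h])
  finally show ?thesis .
qed

lemma L2norm_pd_le_grad: "test_fun \<Omega> f \<Longrightarrow> L2norm M (pd i f) \<le> L2norm M (grad f)"
  using L2norm_nth_le(2)[OF L2_grad_test_fun, of f i] by simp

lemma Poincare: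
  obtains R where "R \<ge> 0" "\<And>f. test_fun \<Omega> f \<Longrightarrow> L2norm M f \<le> R * L2norm M (grad f)"
proof -
  obtain R where "R \<ge> 0" "\<And>f i. test_fun \<Omega> f \<Longrightarrow> L2norm M f \<le> R * L2norm M (pd i f)"
    using Poincare_test_fun by blast
  then show ?thesis
    using that[of R] by (meson L2norm_pd_le_grad mult_left_mono order_trans)
qed

lemma test_fun_trilinear_norm:
  obtains C where "C \<ge> 0"
    "\<And>f g h. test_fun \<Omega> f \<Longrightarrow> test_fun \<Omega> g \<Longrightarrow> test_fun \<Omega> h \<Longrightarrow>
      (\<integral>\<^sup>+x. ennreal \<bar>f x * g x * h x\<bar> \<partial>M)
      \<le> ennreal (C * (L2norm M (grad f) * L2norm M (grad g) * L2norm M (grad h)))"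
proof -
  obtain R where R: "R \<ge> 0" "\<And>f. test_fun \<Omega> f \<Longrightarrow> L2norm M f \<le> R * L2norm M (grad f)"
    using Poincare by blast
  \<comment> \<open>By Cauchy-Schwarz and Poincare the integral of
    \<open>\<bar>2 * f * pd i f\<bar>\<close> is at most \<open>2 * R\<close> times the squared
    gradient norm; \<open>c\<close> is the square root of that constant, and three factors give
    \<open>c^3\<close>.\<close>
  define c where "c = sqrt (2 * R)"
  have c: "c \<ge> 0" using R(1) by (simp add: c_def)
  have b: "esqrt (\<integral>\<^sup>+x. ennreal \<bar>2 * f x * pd i f x\<bar> \<partial>M) \<le> ennreal (c * L2norm M (grad f))"
    if f: "test_fun \<Omega> f" for f i
  proof -
    have L: "L2 M (\<lambda>x. \<bar>f x\<bar>)" "L2 M (\<lambda>x. \<bar>pd i f x\<bar>)"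
      using L2_test_fun[OF f] L2_pd_test_fun[OF f, of i] by (auto simp: L2_def)
    have "(\<integral>\<^sup>+x. ennreal \<bar>2 * f x * pd i f x\<bar> \<partial>M) = ennreal (LINT x|M. \<bar>2 * f x * pd i f x\<bar>)"
      using L2_norm_mult_integrable[OF L2_test_fun[OF f] L2_pd_test_fun[OF f, of i]]
      by (intro nn_integral_eq_integral) (auto simp: abs_mult mult.assoc)
    also have "(LINT x|M. \<bar>2 * f x * pd i f x\<bar>) = 2 * (LINT x|M. \<bar>f x\<bar> * \<bar>pd i f x\<bar>)"
      by (simp add: abs_mult mult.assoc)
    also have "(LINT x|M. \<bar>f x\<bar> * \<bar>pd i f x\<bar>) \<le> L2norm M f * L2norm M (pd i f)"
      using L2_Cauchy_Schwarz[OF L] by (simp add: L2norm_def)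
    also have "\<dots> \<le> (R * L2norm M (grad f)) * L2norm M (grad f)"
      using R f L2norm_pd_le_grad[OF f, of i] by (intro mult_mono) (auto simp: L2norm_nonneg)
    finally have "esqrt (\<integral>\<^sup>+x. ennreal \<bar>2 * f x * pd i f x\<bar> \<partial>M)
        \<le> esqrt (ennreal (2 * ((R * L2norm M (grad f)) * L2norm M (grad f))))"
      by (intro esqrt_mono) (simp add: ennreal_leI)
    also have "\<dots> = ennreal (c * L2norm M (grad f))"
      using R(1) by (subst esqrt_ennreal) (auto simp: c_def L2norm_nonneg real_sqrt_mult mult.assoc)
    finally show ?thesis .
  qed
  show ?thesis
  proof (rule that[of "c^3"])
    fix f g h assume t: "test_fun \<Omega> f" "test_fun \<Omega> g" "test_fun \<Omega> h"
    have "(\<integral>\<^sup>+x. ennreal \<bar>f x * g x * h x\<bar> \<partial>M)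
      \<le> ennreal (c * L2norm M (grad f)) * ennreal (c * L2norm M (grad g)) * ennreal (c * L2norm M (grad h))"
      by (rule order_trans[OF test_fun_trilinear[OF t]]) (intro mult_mono b t; simp)
    also have "\<dots> = ennreal (c^3 * (L2norm M (grad f) * L2norm M (grad g) * L2norm M (grad h)))"
      using c by (simp add: ennreal_mult[symmetric] L2norm_nonneg power3_eq_cube mult_ac)
    finally show "(\<integral>\<^sup>+x. ennreal \<bar>f x * g x * h x\<bar> \<partial>M)
      \<le> ennreal (c^3 * (L2norm M (grad f) * L2norm M (grad g) * L2norm M (grad h)))" .
  qed (use c in simp)
qed

text \<open>The L2 closure of the graph of the gradient on test functions. Carrying \<open>G\<close>
  explicitly makes linear combinations exact, whereas \<open>wgrad\<close> respects them only almost
  everywhere; \<open>H10_imp_pair\<close> and \<open>pair_imp_H10\<close> translate between the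
  two.\<close>

definition H10_pair :: "(R3 \<Rightarrow> real) \<Rightarrow> (R3 \<Rightarrow> R3) \<Rightarrow> bool" where
  "H10_pair u G \<longleftrightarrow> L2 M u \<and> L2 M G \<and>
     (\<exists>f. (\<forall>n. test_fun \<Omega> (f n)) \<and> (\<lambda>n. L2norm M (\<lambda>x. f n x - u x)) \<longlonglongrightarrow> 0 \<and>
          (\<lambda>n. L2norm M (\<lambda>x. grad (f n) x - G x)) \<longlonglongrightarrow> 0)"

lemma H10_pair_test_fun: "test_fun \<Omega> f \<Longrightarrow> H10_pair f (grad f)"
  unfolding H10_pair_def
  by (auto simp: L2_test_fun L2_grad_test_fun L2norm_def intro!: exI[of _ "\<lambda>n. f"])

lemma H10_pair_lin:
  assumes "H10_pair u G" "H10_pair v H"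
  shows "H10_pair (\<lambda>x. a * u x + b * v x) (\<lambda>x. a *\<^sub>R G x + b *\<^sub>R H x)"
proof -
  from assms obtain f g where L: "L2 M u" "L2 M G" "L2 M v" "L2 M H"
    and f: "\<And>n. test_fun \<Omega> (f n)" "(\<lambda>n. L2norm M (\<lambda>x. f n x - u x)) \<longlonglongrightarrow> 0"
      "(\<lambda>n. L2norm M (\<lambda>x. grad (f n) x - G x)) \<longlonglongrightarrow> 0"
    and g: "\<And>n. test_fun \<Omega> (g n)" "(\<lambda>n. L2norm M (\<lambda>x. g n x - v x)) \<longlonglongrightarrow> 0"
      "(\<lambda>n. L2norm M (\<lambda>x. grad (g n) x - H x)) \<longlonglongrightarrow> 0"
    unfolding H10_pair_def by blast
  have "(\<lambda>n. L2norm M (\<lambda>x. a *\<^sub>R (f n x - u x) + b *\<^sub>R (g n x - v x))) \<longlonglongrightarrow> 0"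
    by (intro L2norm_lin_tendsto_0 L2_diff L2_test_fun f g L)
  moreover have "(\<lambda>n. L2norm M (\<lambda>x. a *\<^sub>R (grad (f n) x - G x) + b *\<^sub>R (grad (g n) x - H x))) \<longlonglongrightarrow> 0"
    by (intro L2norm_lin_tendsto_0 L2_diff L2_grad_test_fun f g L)
  ultimately show ?thesis
    unfolding H10_pair_def using L2_lin[OF L(1,3), of a b] L2_lin[OF L(2,4), of a b] f(1) g(1)
    by (auto simp: grad_lin test_fun_lin algebra_simps intro!: exI[of _ "\<lambda>n x. a * f n x + b * g n x"])
qed

lemma H10_pair_AE_limit:
  assumes "H10_pair u G"
  obtains f where "\<And>n. test_fun \<Omega> (f n)" "(\<lambda>n. L2norm M (\<lambda>x. f n x - u x)) \<longlonglongrightarrow> 0"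
    "(\<lambda>n. L2norm M (\<lambda>x. grad (f n) x - G x)) \<longlonglongrightarrow> 0" "AE x in M. (\<lambda>n. f n x) \<longlonglongrightarrow> u x"
proof -
  from assms obtain f where L: "L2 M u" and f: "\<And>n. test_fun \<Omega> (f n)"
    "(\<lambda>n. L2norm M (\<lambda>x. f n x - u x)) \<longlonglongrightarrow> 0" "(\<lambda>n. L2norm M (\<lambda>x. grad (f n) x - G x)) \<longlonglongrightarrow> 0"
    unfolding H10_pair_def by blast
  obtain r where r: "strict_mono r" "AE x in M. (\<lambda>n. f (r n) x) \<longlonglongrightarrow> u x"
    using L2_AE_subseq[OF L2_test_fun[OF f(1)] L f(2)] by blast
  show ?thesis
    using that[of "\<lambda>n. f (r n)"] f(1) r(2) LIMSEQ_subseq_LIMSEQ[OF f(2) r(1)]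
      LIMSEQ_subseq_LIMSEQ[OF f(3) r(1)] by (simp add: o_def)
qed

text \<open>Fatou's lemma along almost everywhere convergent test functions. It yields integrability
  of the product as a conclusion, since the bounds for the approximants converge to the bound for
  the limit.\<close>

lemma H10_pair_trilinear:
  obtains C where "C \<ge> 0"
    "\<And>u v w G H J. H10_pair u G \<Longrightarrow> H10_pair v H \<Longrightarrow> H10_pair w J \<Longrightarrow>
      integrable M (\<lambda>x. u x * v x * w x) \<and>
      (LINT x|M. \<bar>u x * v x * w x\<bar>) \<le> C * (L2norm M G * L2norm M H * L2norm M J)"
proof -
  obtain C where C: "C \<ge> 0" "\<And>f g h. test_fun \<Omega> f \<Longrightarrow> test_fun \<Omega> g \<Longrightarrow> test_fun \<Omega> h \<Longrightarrow>
      (\<integral>\<^sup>+x. ennreal \<bar>f x * g x * h x\<bar> \<partial>M)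
      \<le> ennreal (C * (L2norm M (grad f) * L2norm M (grad g) * L2norm M (grad h)))"
    using test_fun_trilinear_norm by blast
  show ?thesis
  proof (rule that[OF C(1)])
    fix u v w G H J assume p: "H10_pair u G" "H10_pair v H" "H10_pair w J"
    have L: "L2 M u" "L2 M v" "L2 M w" "L2 M G" "L2 M H" "L2 M J" using p by (auto simp: H10_pair_def)
    note [measurable] = L2_measurable[OF L(1)] L2_measurable[OF L(2)] L2_measurable[OF L(3)]
    obtain f where f: "\<And>n. test_fun \<Omega> (f n)" "(\<lambda>n. L2norm M (\<lambda>x. grad (f n) x - G x)) \<longlonglongrightarrow> 0"
      "AE x in M. (\<lambda>n. f n x) \<longlonglongrightarrow> u x" using H10_pair_AE_limit[OF p(1)] by blast
    obtain g where g: "\<And>n. test_fun \<Omega> (g n)" "(\<lambda>n. L2norm M (\<lambda>x. grad (g n) x - H x)) \<longlonglongrightarrow> 0"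
      "AE x in M. (\<lambda>n. g n x) \<longlonglongrightarrow> v x" using H10_pair_AE_limit[OF p(2)] by blast
    obtain h where h: "\<And>n. test_fun \<Omega> (h n)" "(\<lambda>n. L2norm M (\<lambda>x. grad (h n) x - J x)) \<longlonglongrightarrow> 0"
      "AE x in M. (\<lambda>n. h n x) \<longlonglongrightarrow> w x" using H10_pair_AE_limit[OF p(3)] by blast
    define B where "B n = C * (L2norm M (grad (f n)) * L2norm M (grad (g n)) * L2norm M (grad (h n)))" for n
    let ?B = "C * (L2norm M G * L2norm M H * L2norm M J)"
    have B: "B \<longlonglongrightarrow> ?B"
      unfolding B_def by (intro tendsto_intros L2norm_tendsto L2_grad_test_fun f g h L)
    have [measurable]: "f n \<in> borel_measurable M" "g n \<in> borel_measurable M" "h n \<in> borel_measurable M" for n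
      by (intro L2_measurable L2_test_fun f g h)+
    have "(\<integral>\<^sup>+x. ennreal \<bar>u x * v x * w x\<bar> \<partial>M) = (\<integral>\<^sup>+x. liminf (\<lambda>n. ennreal \<bar>f n x * g n x * h n x\<bar>) \<partial>M)"
    proof (rule nn_integral_cong_AE, use f(3) g(3) h(3) in eventually_elim)
      case (elim x)
      have "(\<lambda>n. ennreal \<bar>f n x * g n x * h n x\<bar>) \<longlonglongrightarrow> ennreal \<bar>u x * v x * w x\<bar>"
        by (intro tendsto_ennrealI tendsto_intros elim)
      then show ?case by (intro lim_imp_Liminf[symmetric]) simp_all
    qed
    also have "\<dots> \<le> liminf (\<lambda>n. \<integral>\<^sup>+x. ennreal \<bar>f n x * g n x * h n x\<bar> \<partial>M)"
      by (rule nn_integral_liminf) measurable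
    also have "\<dots> \<le> liminf (\<lambda>n. ennreal (B n))"
      unfolding B_def by (intro Liminf_mono always_eventually allI C(2) f g h)
    also have "\<dots> = ennreal ?B"
      by (intro lim_imp_Liminf tendsto_ennrealI B) simp
    finally have le: "(\<integral>\<^sup>+x. ennreal \<bar>u x * v x * w x\<bar> \<partial>M) \<le> ennreal ?B" .
    have i: "integrable M (\<lambda>x. u x * v x * w x)"
    proof (rule integrableI_bounded)
      show "(\<integral>\<^sup>+x. ennreal (norm (u x * v x * w x)) \<partial>M) < \<infinity>"
        using le_less_trans[OF le] by simp
    qed measurable
    have "(\<integral>\<^sup>+x. ennreal \<bar>u x * v x * w x\<bar> \<partial>M) = ennreal (LINT x|M. \<bar>u x * v x * w x\<bar>)"
      using i by (intro nn_integral_eq_integral integrable_abs) simp_all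
    with le have "(LINT x|M. \<bar>u x * v x * w x\<bar>) \<le> ?B"
      using C(1) by (simp add: ennreal_le_iff L2norm_nonneg)
    with i show "integrable M (\<lambda>x. u x * v x * w x) \<and> (LINT x|M. \<bar>u x * v x * w x\<bar>) \<le> ?B" by blast
  qed
qed

section \<open>Weak gradients\<close>

lemma Lp_2_iff: "Lp \<Omega> 2 u \<longleftrightarrow> L2 M u"
  by (simp add: Lp_def L2_def)

lemma Lnorm_2_eq: "Lnorm \<Omega> 2 u = L2norm M u"
  by (simp add: Lnorm_def L2norm_def powr_half_sqrt)

lemma L2_vec_iff: "L2 M G \<longleftrightarrow> (\<forall>i. L2 M (\<lambda>x. G x $ i))" for G :: "R3 \<Rightarrow> R3"
proof
  assume "L2 M G"
  then show "\<forall>i. L2 M (\<lambda>x. G x $ i)" by (simp add: L2norm_nth_le)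
next
  assume L: "\<forall>i. L2 M (\<lambda>x. G x $ i)"
  have e: "(norm (G x))\<^sup>2 = (\<Sum>i\<in>UNIV. (norm (G x $ i))\<^sup>2)" for x
    unfolding power2_norm_eq_inner by (simp add: inner_vec_def)
  have "G \<in> borel_measurable M"
    unfolding borel_measurable_euclidean_space[of G]
    using L by (auto simp: Basis_vec_def inner_axis L2_def)
  then show "L2 M G"
    using L by (auto simp: L2_def e)
qed

lemma loc_integrable_L2:
  assumes "L2 M u" shows "loc_integrable \<Omega> u"
  unfolding loc_integrable_def
proof safe
  fix C :: "R3 set" assume C: "compact C" "C \<subseteq> \<Omega>"
  have Cs: "C \<in> sets lebesgue" using C(1) by (simp add: borel_compact sets_completionI_sets)
  have "integrable lebesgue (\<lambda>x. indicator \<Omega> x *\<^sub>R u x)"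
    using L2_integrable[OF assms] by (subst (asm) integrable_restrict_space) auto
  from integrable_mult_indicator[OF Cs this]
  have "integrable lebesgue (\<lambda>x. indicator C x *\<^sub>R u x)"
    by (rule Bochner_Integration.integrable_cong[THEN iffD1, rotated 2])
      (use C(2) in \<open>auto simp: indicator_def\<close>)
  then show "integrable (lebesgue_on C) u"
    using Cs by (subst integrable_restrict_space) auto
qed

lemma weak_gradI:
  assumes "L2 M u" "L2 M G"
    and "\<And>i f. test_fun \<Omega> f \<Longrightarrow> (LINT x|M. u x * pd i f x) = - (LINT x|M. G x $ i * f x)"
  shows "weak_grad \<Omega> u G"
  using assms by (auto simp: weak_grad_def L2_vec_iff intro!: loc_integrable_L2)

lemma weak_gradD:
  "weak_grad \<Omega> u G \<Longrightarrow> test_fun \<Omega> f \<Longrightarrow> (LINT x|M. u x * pd i f x) = - (LINT x|M. G x $ i * f x)"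
  by (simp add: weak_grad_def)

lemma L2_times_integrable:
  fixes f g :: "R3 \<Rightarrow> real"
  shows "L2 M f \<Longrightarrow> L2 M g \<Longrightarrow> integrable M (\<lambda>x. f x * g x)"
  using L2_inner_integrable[of M f g] by simp

lemma weak_grad_diff:
  assumes L: "L2 M u" "L2 M G" "L2 M v" "L2 M H" and w: "weak_grad \<Omega> u G" "weak_grad \<Omega> v H"
  shows "weak_grad \<Omega> (\<lambda>x. u x - v x) (\<lambda>x. G x - H x)"
proof (rule weak_gradI)
  fix i f assume f: "test_fun \<Omega> f"
  note Lf = L2_test_fun[OF f] L2_pd_test_fun[OF f, of i]
  have "L2 M (\<lambda>x. G x $ i)" "L2 M (\<lambda>x. H x $ i)" using L by (simp_all add: L2_vec_iff)
  then show "(LINT x|M. (u x - v x) * pd i f x) = - (LINT x|M. (G x - H x) $ i * f x)"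
    using weak_gradD[OF w(1) f, of i] weak_gradD[OF w(2) f, of i] L Lf
    by (simp add: left_diff_distrib L2_times_integrable)
qed (intro L2_diff L)+

text \<open>Each component of \<open>G - H\<close> annihilates all test functions.\<close>

lemma weak_grad_unique:
  assumes L: "L2 M G" "L2 M H" and w: "weak_grad \<Omega> u G" "weak_grad \<Omega> u H"
  shows "AE x in M. G x = H x"
proof -
  have c: "AE x in M. G x $ i - H x $ i = 0" for i
  proof (rule fundamental_lemma)
    have Li: "L2 M (\<lambda>x. G x $ i)" "L2 M (\<lambda>x. H x $ i)" using L by (simp_all add: L2_vec_iff)
    then show "L2 M (\<lambda>x. G x $ i - H x $ i)" by (rule L2_diff)
    fix f assume f: "test_fun \<Omega> f"
    show "(LINT x|M. (G x $ i - H x $ i) * f x) = 0"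
      using weak_gradD[OF w(1) f, of i] weak_gradD[OF w(2) f, of i] Li L2_test_fun[OF f]
      by (simp add: left_diff_distrib L2_times_integrable)
  qed
  then have "AE x in M. \<forall>i\<in>UNIV. G x $ i - H x $ i = 0"
    by (subst AE_ball_countable) auto
  then show ?thesis by eventually_elim (simp add: vec_eq_iff)
qed

text \<open>Integration by parts holds for the approximating test functions, and both sides are
  continuous under L2 limits.\<close>

lemma H10_pair_weak_grad:
  assumes "H10_pair u G" shows "weak_grad \<Omega> u G"
proof -
  from assms obtain f where L: "L2 M u" "L2 M G" and f: "\<And>n. test_fun \<Omega> (f n)"
    "(\<lambda>n. L2norm M (\<lambda>x. f n x - u x)) \<longlonglongrightarrow> 0" "(\<lambda>n. L2norm M (\<lambda>x. grad (f n) x - G x)) \<longlonglongrightarrow> 0"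
    unfolding H10_pair_def by blast
  show ?thesis
  proof (rule weak_gradI[OF L])
    fix i g assume g: "test_fun \<Omega> g"
    have 1: "(\<lambda>n. LINT x|M. f n x \<bullet> pd i g x) \<longlonglongrightarrow> (LINT x|M. u x \<bullet> pd i g x)"
      by (intro L2_inner_tendsto L2_test_fun L2_pd_test_fun f g L)
    \<comment> \<open>Multiplying one component by a scalar is written as an inner product with an
      axis vector, so that \<open>L2_inner_tendsto\<close> applies to the whole gradient
      field.\<close>
    have ax: "v $ i * c = v \<bullet> axis i c" for v :: R3 and c by (simp add: inner_axis)
    have Lg: "L2 M (\<lambda>x. axis i (g x) :: R3)"
      unfolding L2_vec_iff
    proof
      fix j
      show "L2 M (\<lambda>x. (axis i (g x) :: R3) $ j)"
        using L2_test_fun[OF g] L2_bounded[of "\<lambda>x. 0::real" 0]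
        by (cases "j = i") (simp_all add: axis_def)
    qed
    have 2: "(\<lambda>n. LINT x|M. grad (f n) x \<bullet> axis i (g x)) \<longlonglongrightarrow> (LINT x|M. G x \<bullet> axis i (g x))"
      by (intro L2_inner_tendsto L2_grad_test_fun f Lg L)
    have "(LINT x|M. f n x \<bullet> pd i g x) = - (LINT x|M. grad (f n) x \<bullet> axis i (g x))" for n
      using test_fun_by_parts[OF f(1) g, of n i] by (simp add: inner_axis)
    then have "(\<lambda>n. LINT x|M. f n x \<bullet> pd i g x) \<longlonglongrightarrow> - (LINT x|M. G x \<bullet> axis i (g x))"
      using tendsto_minus[OF 2] by simp
    from LIMSEQ_unique[OF 1 this]
    show "(LINT x|M. u x * pd i g x) = - (LINT x|M. G x $ i * g x)" by (simp add: ax)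
  qed
qed

lemma weak_grad_test_fun: "test_fun \<Omega> f \<Longrightarrow> weak_grad \<Omega> f (grad f)"
  by (intro H10_pair_weak_grad H10_pair_test_fun)

text \<open>Any L2 weak gradient \<open>G\<close> shows that the choice in \<open>wgrad\<close> is
  not vacuous; uniqueness then ties the chosen field to \<open>G\<close>.\<close>

lemma wgrad_props:
  assumes "weak_grad \<Omega> u G" "L2 M G"
  shows "weak_grad \<Omega> u (wgrad \<Omega> u)" "L2 M (wgrad \<Omega> u)" "AE x in M. wgrad \<Omega> u x = G x"
proof -
  have "weak_grad \<Omega> u (wgrad \<Omega> u) \<and> (\<forall>i. Lp \<Omega> 2 (\<lambda>x. wgrad \<Omega> u x $ i))"
    unfolding wgrad_def by (rule someI[of _ G]) (use assms in \<open>simp add: Lp_2_iff L2_vec_iff\<close>)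
  then show 1: "weak_grad \<Omega> u (wgrad \<Omega> u)" "L2 M (wgrad \<Omega> u)"
    by (auto simp: Lp_2_iff L2_vec_iff)
  show "AE x in M. wgrad \<Omega> u x = G x"
    by (rule weak_grad_unique[OF 1(2) assms(2) 1(1) assms(1)])
qed

lemma H1_wgrad:
  assumes "H1 \<Omega> u"
  shows "L2 M u" "weak_grad \<Omega> u (wgrad \<Omega> u)" "L2 M (wgrad \<Omega> u)"
proof -
  obtain G where "L2 M u" "weak_grad \<Omega> u G" "L2 M G"
    using assms by (auto simp: H1_def Lp_2_iff L2_vec_iff)
  then show "L2 M u" "weak_grad \<Omega> u (wgrad \<Omega> u)" "L2 M (wgrad \<Omega> u)"
    using wgrad_props by blast+
qed

text \<open>\<open>H1norm\<close> uses the gradient chosen for the difference, which may differ from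
  \<open>grad f - G\<close> on a null set; the L2 norm does not see it.\<close>

lemma H1norm_diff:
  assumes "L2 M u" "L2 M G" "weak_grad \<Omega> u G" and f: "test_fun \<Omega> f"
  shows "H1norm \<Omega> (\<lambda>x. f x - u x) = L2norm M (\<lambda>x. f x - u x) + L2norm M (\<lambda>x. grad f x - G x)"
proof -
  have w: "weak_grad \<Omega> (\<lambda>x. f x - u x) (\<lambda>x. grad f x - G x)"
    by (intro weak_grad_diff L2_test_fun L2_grad_test_fun weak_grad_test_fun assms)
  have L: "L2 M (\<lambda>x. grad f x - G x)" by (intro L2_diff L2_grad_test_fun assms)
  have "L2norm M (wgrad \<Omega> (\<lambda>x. f x - u x)) = L2norm M (\<lambda>x. grad f x - G x)"
    by (intro L2norm_cong_AE L2_measurable L wgrad_props[OF w L])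
  then show ?thesis by (simp add: H1norm_def Lnorm_2_eq L2norm_norm)
qed

lemma H10_imp_pair:
  assumes "H10 \<Omega> u" shows "H10_pair u (wgrad \<Omega> u)"
proof -
  from assms obtain f where u: "H1 \<Omega> u" and f: "\<And>n. test_fun \<Omega> (f n)"
    and lim: "(\<lambda>n. H1norm \<Omega> (\<lambda>x. f n x - u x)) \<longlonglongrightarrow> 0" unfolding H10_def by blast
  have e: "H1norm \<Omega> (\<lambda>x. f n x - u x) = L2norm M (\<lambda>x. f n x - u x) + L2norm M (\<lambda>x. grad (f n) x - wgrad \<Omega> u x)" for n
    by (intro H1norm_diff H1_wgrad u f)
  have "(\<lambda>n. L2norm M (\<lambda>x. f n x - u x)) \<longlonglongrightarrow> 0"
    by (rule tendsto_sandwich[OF _ _ tendsto_const lim]) (auto simp: e L2norm_nonneg)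
  moreover have "(\<lambda>n. L2norm M (\<lambda>x. grad (f n) x - wgrad \<Omega> u x)) \<longlonglongrightarrow> 0"
    by (rule tendsto_sandwich[OF _ _ tendsto_const lim]) (auto simp: e L2norm_nonneg)
  ultimately show ?thesis
    unfolding H10_pair_def using H1_wgrad[OF u] f by blast
qed

lemma pair_imp_H10:
  assumes "H10_pair u G"
  shows "H10 \<Omega> u" "AE x in M. wgrad \<Omega> u x = G x"
proof -
  from assms obtain f where L: "L2 M u" "L2 M G" and f: "\<And>n. test_fun \<Omega> (f n)"
    "(\<lambda>n. L2norm M (\<lambda>x. f n x - u x)) \<longlonglongrightarrow> 0" "(\<lambda>n. L2norm M (\<lambda>x. grad (f n) x - G x)) \<longlonglongrightarrow> 0"
    unfolding H10_pair_def by blast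
  note w = H10_pair_weak_grad[OF assms]
  have "(\<lambda>n. H1norm \<Omega> (\<lambda>x. f n x - u x)) \<longlonglongrightarrow> 0"
    unfolding H1norm_diff[OF L w f(1)] using tendsto_add[OF f(2,3)] by simp
  then show "H10 \<Omega> u"
    unfolding H10_def H1_def using L w f(1) by (auto simp: Lp_2_iff L2_vec_iff)
  show "AE x in M. wgrad \<Omega> u x = G x" by (rule wgrad_props[OF w L(2)])
qed

section \<open>Solvability of the Poisson equation\<close>

text \<open>Minimising sequences of \<open>\<parallel>\<nabla>f\<parallel>\<^sup>2 - 2 \<ell> f\<close> are Cauchy by the parallelogram law.\<close>

lemma Riesz_H10:
  fixes l :: "(R3 \<Rightarrow> real) \<Rightarrow> real"
  assumes lin: "\<And>f g a b. test_fun \<Omega> f \<Longrightarrow> test_fun \<Omega> g \<Longrightarrow> l (\<lambda>x. a * f x + b * g x) = a * l f + b * l g"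
    and bd: "\<And>f. test_fun \<Omega> f \<Longrightarrow> \<bar>l f\<bar> \<le> c * L2norm M (grad f)"
  obtains \<phi> G where "H10_pair \<phi> G" "\<And>g. test_fun \<Omega> g \<Longrightarrow> (LINT x|M. G x \<bullet> grad g x) = l g"
proof -
  define J where "J f = (L2norm M (grad f))\<^sup>2 - 2 * l f" for f
  define T where "T = {f. test_fun \<Omega> f}"
  define m where "m = Inf (J ` T)"
  have ne: "J ` T \<noteq> {}" using test_fun_zero by (auto simp: T_def)
  \<comment> \<open>Complete the square: with \<open>N\<close> the gradient norm,
    \<open>J f \<ge> N\<^sup>2 - 2 * c * N \<ge> - c\<^sup>2\<close>.\<close>
  have "- c\<^sup>2 \<le> J f" if "f \<in> T" for f
  proof -
    have "0 \<le> (L2norm M (grad f) - c)\<^sup>2" by simp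
    then show ?thesis using bd[of f] that
      by (simp add: J_def T_def power2_diff mult.commute)
  qed
  then have bb: "bdd_below (J ` T)" by (intro bdd_belowI[of _ "- c\<^sup>2"]) auto
  have mJ: "m \<le> J f" if "test_fun \<Omega> f" for f
    unfolding m_def using bb that by (intro cInf_lower) (auto simp: T_def)
  have "\<exists>f. test_fun \<Omega> f \<and> J f < m + 1 / real (Suc n)" for n
    using cInf_lessD[OF ne, of "m + 1 / real (Suc n)"] unfolding m_def by (auto simp: T_def)
  then obtain f where f: "\<And>n. test_fun \<Omega> (f n)" "\<And>n. J (f n) < m + 1 / real (Suc n)"
    by metis
  have sq: "(L2norm M (grad (\<lambda>x. a * g x + b * h x)))\<^sup>2 = a\<^sup>2 * (L2norm M (grad g))\<^sup>2
      + 2 * a * b * (LINT x|M. grad g x \<bullet> grad h x) + b\<^sup>2 * (L2norm M (grad h))\<^sup>2"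
    if "test_fun \<Omega> g" "test_fun \<Omega> h" for a b g h
    using that by (simp add: grad_lin L2norm_sq_lin L2_grad_test_fun)
  have cau: "(L2norm M (\<lambda>x. grad (f i) x - grad (f j) x))\<^sup>2 \<le> 2 / real (Suc i) + 2 / real (Suc j)" for i j
  proof -
    \<comment> \<open>The midpoint has energy at least \<open>m\<close>, while \<open>f i\<close>
      and \<open>f j\<close> exceed \<open>m\<close> by less than \<open>1 / Suc i\<close> and
      \<open>1 / Suc j\<close>. The parallelogram identity leaves only the difference of the
      gradients.\<close>
    have "m \<le> J (\<lambda>x. (1/2) * f i x + (1/2) * f j x)" by (intro mJ test_fun_lin f)
    also have "4 * \<dots> = 2 * J (f i) + 2 * J (f j) - (L2norm M (\<lambda>x. grad (f i) x - grad (f j) x))\<^sup>2"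
      using sq[OF f(1) f(1), of "1/2" i "1/2" j] L2norm_sq_lin[OF L2_grad_test_fun[OF f(1)] L2_grad_test_fun[OF f(1)], of 1 i "-1" j]
        lin[OF f(1) f(1), of "1/2" i "1/2" j]
      by (simp add: J_def power2_eq_square algebra_simps)
    finally show ?thesis using f(2)[of i] f(2)[of j] by simp
  qed
  have small: "\<exists>N. \<forall>i\<ge>N. \<forall>j\<ge>N. L2norm M (\<lambda>x. grad (f i) x - grad (f j) x) < e" if "e > 0" for e
  proof -
    obtain N where N: "4 / e\<^sup>2 < real N" using reals_Archimedean2 by blast
    show ?thesis
    proof (intro exI allI impI)
      fix i j assume ij: "i \<ge> N" "j \<ge> N"
      have N0: "real N > 0" using N \<open>e > 0\<close> by (smt (verit) divide_pos_pos zero_less_power)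
      have "2 / real (Suc k) \<le> 2 / real N" if "k \<ge> N" for k
        using N0 that by (intro divide_left_mono) auto
      from this[OF ij(1)] this[OF ij(2)] have "(L2norm M (\<lambda>x. grad (f i) x - grad (f j) x))\<^sup>2 \<le> 4 / real N"
        using cau[of i j] by simp
      also have "\<dots> < e\<^sup>2" using N N0 \<open>e > 0\<close> by (simp add: field_simps)
      finally show "L2norm M (\<lambda>x. grad (f i) x - grad (f j) x) < e"
        using \<open>e > 0\<close> by (simp add: power2_less_imp_less)
    qed
  qed
  obtain G where G: "L2 M G" "(\<lambda>n. L2norm M (\<lambda>x. grad (f n) x - G x)) \<longlonglongrightarrow> 0"
    using L2_complete[OF L2_grad_test_fun[OF f(1)] small] by blast
  obtain R where R: "R \<ge> 0" "\<And>f. test_fun \<Omega> f \<Longrightarrow> L2norm M f \<le> R * L2norm M (grad f)"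
    using Poincare by blast
  have small': "\<exists>N. \<forall>i\<ge>N. \<forall>j\<ge>N. L2norm M (\<lambda>x. f i x - f j x) < e" if "e > 0" for e
  proof -
    \<comment> \<open>Poincare transfers the Cauchy property from gradients to functions;
      \<open>R + 1\<close> avoids dividing by a possibly zero \<open>R\<close>.\<close>
    obtain N where N: "\<And>i j. i \<ge> N \<Longrightarrow> j \<ge> N \<Longrightarrow> L2norm M (\<lambda>x. grad (f i) x - grad (f j) x) < e / (R + 1)"
      using small[of "e / (R + 1)"] R(1) \<open>e > 0\<close> by auto
    show ?thesis
    proof (intro exI allI impI)
      fix i j assume ij: "i \<ge> N" "j \<ge> N"
      have "L2norm M (\<lambda>x. f i x - f j x) \<le> R * L2norm M (\<lambda>x. grad (f i) x - grad (f j) x)"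
        using R(2)[OF test_fun_diff[OF f(1) f(1)], of i j] by (simp add: grad_diff f)
      also have "\<dots> \<le> (R + 1) * L2norm M (\<lambda>x. grad (f i) x - grad (f j) x)"
        by (intro mult_right_mono) (auto simp: L2norm_nonneg)
      also have "\<dots> < e" using N[OF ij] R(1) by (simp add: pos_less_divide_eq mult.commute)
      finally show "L2norm M (\<lambda>x. f i x - f j x) < e" .
    qed
  qed
  obtain \<phi> where \<phi>: "L2 M \<phi>" "(\<lambda>n. L2norm M (\<lambda>x. f n x - \<phi> x)) \<longlonglongrightarrow> 0"
    using L2_complete[OF L2_test_fun[OF f(1)] small'] by blast
  have p: "H10_pair \<phi> G" unfolding H10_pair_def using G \<phi> f(1) by blast
  moreover have "(LINT x|M. G x \<bullet> grad g x) = l g" if g: "test_fun \<Omega> g" for g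
  proof -
    define d where "d n = (LINT x|M. grad (f n) x \<bullet> grad g x) - l g" for n
    define Q where "Q = (L2norm M (grad g))\<^sup>2"
    have Q0: "Q \<ge> 0" by (simp add: Q_def)
    \<comment> \<open>Varying the approximate minimiser \<open>f n\<close> in direction
      \<open>g\<close> gives the Euler equation up to the error \<open>1 / Suc n\<close>, so
      \<open>J\<close> need not be extended to the limit.\<close>
    have q: "0 \<le> 2 * t * d n + t\<^sup>2 * Q + 1 / real (Suc n)" for t n
    proof -
      have "m \<le> J (\<lambda>x. 1 * f n x + t * g x)" by (intro mJ test_fun_lin f g)
      also have "\<dots> = J (f n) + 2 * t * d n + t\<^sup>2 * Q"
        using sq[OF f(1) g, of 1 n t] lin[OF f(1) g, of 1 n t]
        by (simp add: J_def d_def Q_def algebra_simps)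
      finally show ?thesis using f(2)[of n] by simp
    qed
    \<comment> \<open>For \<open>Q > 0\<close> the minimising parameter is
      \<open>t = - d n / Q\<close>. For \<open>Q = 0\<close> a nonzero \<open>d n\<close> is
      impossible, as \<open>t = - 1 / d n\<close> would give
      \<open>-2 + 1 / Suc n < 0\<close>.\<close>
    have db: "(d n)\<^sup>2 \<le> Q * (1 / real (Suc n))" for n
    proof (cases "Q = 0")
      case True
      have "d n = 0"
      proof (rule ccontr)
        assume "d n \<noteq> 0"
        then show False using q[of "- 1 / d n" n] True
          by (simp add: field_simps)
      qed
      then show ?thesis using True by simp
    next
      case False
      have e: "Q * (2 * (- y / Q) * y + (- y / Q)\<^sup>2 * Q + e) = - y\<^sup>2 + Q * e" for y e
        using False by (simp add: field_simps power2_eq_square)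
      have "0 \<le> Q * (2 * (- d n / Q) * d n + (- d n / Q)\<^sup>2 * Q + 1 / real (Suc n))"
        using q[of "- d n / Q" n] Q0 by (intro mult_nonneg_nonneg)
      also have "\<dots> = - (d n)\<^sup>2 + Q * (1 / real (Suc n))"
        by (rule e)
      finally show ?thesis by simp
    qed
    have "(\<lambda>n. (d n)\<^sup>2) \<longlonglongrightarrow> 0"
    proof (rule tendsto_sandwich[OF _ _ tendsto_const])
      show "(\<lambda>n. Q * (1 / real (Suc n))) \<longlonglongrightarrow> 0"
        using tendsto_mult[OF tendsto_const[of Q] LIMSEQ_Suc[OF lim_1_over_n]] by simp
    qed (use db in auto)
    then have "d \<longlonglongrightarrow> 0" by (simp add: tendsto_power_zero power_tendsto_0_iff)
    moreover have "d \<longlonglongrightarrow> (LINT x|M. G x \<bullet> grad g x) - l g"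
      unfolding d_def by (intro tendsto_intros L2_inner_tendsto L2_grad_test_fun f g G)
    ultimately show ?thesis using LIMSEQ_unique by fastforce
  qed
  ultimately show ?thesis by (rule that)
qed

lemma Linf_mult:
  assumes "Linf \<Omega> K"
  obtains B where "B \<ge> 0"
    "\<And>f. integrable M f \<Longrightarrow> integrable M (\<lambda>x. K x * f x) \<and> \<bar>LINT x|M. K x * f x\<bar> \<le> B * (LINT x|M. \<bar>f x\<bar>)"
proof -
  from assms obtain C where Km[measurable]: "K \<in> borel_measurable M" and C: "AE x in M. \<bar>K x\<bar> \<le> C"
    by (auto simp: Linf_def)
  have b: "AE x in M. norm (K x * f x) \<le> max C 0 * \<bar>f x\<bar>" for f :: "R3 \<Rightarrow> real"
    using C by eventually_elim (auto simp: abs_mult intro!: mult_right_mono)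
  show ?thesis
  \<comment> \<open>\<open>C\<close> bounds only almost everywhere; the maximum makes the constant
    nonnegative without appeal to the size of the domain.\<close>
  proof (rule that[of "max C 0"])
    fix f :: "R3 \<Rightarrow> real" assume f: "integrable M f"
    then have [measurable]: "f \<in> borel_measurable M" by simp
    have i: "integrable M (\<lambda>x. K x * f x)"
    proof (rule Bochner_Integration.integrable_bound)
      show "integrable M (\<lambda>x. max C 0 * \<bar>f x\<bar>)" using f by simp
      show "AE x in M. norm (K x * f x) \<le> norm (max C 0 * \<bar>f x\<bar>)"
        using b[of f] by eventually_elim simp
    qed measurable
    have "\<bar>LINT x|M. K x * f x\<bar> \<le> (LINT x|M. norm (K x * f x))"
      using integral_norm_bound[of M "\<lambda>x. K x * f x"] by simp
    also have "\<dots> \<le> (LINT x|M. max C 0 * \<bar>f x\<bar>)"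
      using f i b[of f] by (intro integral_mono_AE) auto
    finally show "integrable M (\<lambda>x. K x * f x) \<and> \<bar>LINT x|M. K x * f x\<bar> \<le> max C 0 * (LINT x|M. \<bar>f x\<bar>)"
      using i by simp
  qed simp
qed

text \<open>The trilinear bound with \<open>u\<close> in two slots makes the right-hand side a
  bounded functional, which \<open>Riesz_H10\<close> represents on test functions; density extends
  the equation to \<open>H10\<close>, and the choice inherits it. Membership in \<open>H10\<close>
  is what allows \<phi> as a factor in the trilinear bound again.\<close>

lemma phi_of_H10:
  assumes K: "Linf \<Omega> K" and u: "H10 \<Omega> u"
  shows "H10 \<Omega> (phi_of \<Omega> K u)"
proof -
  define U where "U = wgrad \<Omega> u"
  have pu: "H10_pair u U" unfolding U_def by (rule H10_imp_pair[OF u])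
  obtain B where B: "B \<ge> 0" "\<And>f. integrable M f \<Longrightarrow>
      integrable M (\<lambda>x. K x * f x) \<and> \<bar>LINT x|M. K x * f x\<bar> \<le> B * (LINT x|M. \<bar>f x\<bar>)"
    by (rule Linf_mult[OF K]) (rule that; blast)
  obtain C where C: "C \<ge> 0" "\<And>u v w G H J. H10_pair u G \<Longrightarrow> H10_pair v H \<Longrightarrow> H10_pair w J \<Longrightarrow>
      integrable M (\<lambda>x. u x * v x * w x) \<and>
      (LINT x|M. \<bar>u x * v x * w x\<bar>) \<le> C * (L2norm M G * L2norm M H * L2norm M J)"
    by (rule H10_pair_trilinear) (rule that; blast)
  define l where "l w = (LINT x|M. K x * (u x)\<^sup>2 * w x)" for w
  define c where "c = B * (C * (L2norm M U * L2norm M U))"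
  have li: "integrable M (\<lambda>x. K x * (u x)\<^sup>2 * w x)" if "H10_pair w J" for w J
    using B(2)[of "\<lambda>x. u x * u x * w x"] C(2)[OF pu pu that] by (simp add: power2_eq_square mult.assoc)
  have lb: "\<bar>l w\<bar> \<le> c * L2norm M J" if w: "H10_pair w J" for w J
  proof -
    have "\<bar>l w\<bar> \<le> B * (LINT x|M. \<bar>u x * u x * w x\<bar>)"
      using B(2)[of "\<lambda>x. u x * u x * w x"] C(2)[OF pu pu w] by (simp add: l_def power2_eq_square mult.assoc)
    also have "\<dots> \<le> B * (C * (L2norm M U * L2norm M U * L2norm M J))"
      using B(1) C(2)[OF pu pu w] by (intro mult_left_mono) auto
    finally show ?thesis by (simp add: c_def mult.assoc)
  qed
  have ll: "l (\<lambda>x. a * v x + b * w x) = a * l v + b * l w" if "H10_pair v H" "H10_pair w J" for v w H J a b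
  proof -
    have "K x * (u x)\<^sup>2 * (a * v x + b * w x) = a * (K x * (u x)\<^sup>2 * v x) + b * (K x * (u x)\<^sup>2 * w x)" for x
      by (simp add: algebra_simps)
    then show ?thesis using li[OF that(1)] li[OF that(2)] by (simp add: l_def)
  qed
  obtain \<phi> G where \<phi>: "H10_pair \<phi> G" "\<And>g. test_fun \<Omega> g \<Longrightarrow> (LINT x|M. G x \<bullet> grad g x) = l g"
    by (rule Riesz_H10[of l c]) (use ll lb H10_pair_test_fun in blast)+
  have "(LINT x|M. wgrad \<Omega> \<phi> x \<bullet> wgrad \<Omega> w x) = l w" if w: "H10 \<Omega> w" for w
  proof -
    let ?J = "wgrad \<Omega> w"
    have pw: "H10_pair w ?J" by (rule H10_imp_pair[OF w])
    then obtain g where g: "\<And>n. test_fun \<Omega> (g n)" "(\<lambda>n. L2norm M (\<lambda>x. grad (g n) x - ?J x)) \<longlonglongrightarrow> 0"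
      and LJ: "L2 M ?J" unfolding H10_pair_def by blast
    have LG: "L2 M G" "L2 M (wgrad \<Omega> \<phi>)"
      using \<phi>(1) H10_imp_pair[OF pair_imp_H10(1)[OF \<phi>(1)]] by (auto simp: H10_pair_def)
    have "(\<lambda>n. LINT x|M. grad (g n) x \<bullet> G x) \<longlonglongrightarrow> (LINT x|M. ?J x \<bullet> G x)"
      by (intro L2_inner_tendsto L2_grad_test_fun g LJ LG)
    then have 1: "(\<lambda>n. l (g n)) \<longlonglongrightarrow> (LINT x|M. G x \<bullet> ?J x)"
      using \<phi>(2)[OF g(1)] by (simp add: inner_commute)
    \<comment> \<open>By linearity the difference is \<open>l\<close> at \<open>g n - w\<close>,
      bounded by \<open>c\<close> times the gradient distance.\<close>
    have "(\<lambda>n. l (g n) - l w) \<longlonglongrightarrow> 0"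
    proof (rule tendsto_0_le[OF g(2), of _ c], rule always_eventually, rule allI)
      fix n
      have "l (g n) - l w = l (\<lambda>x. 1 * g n x + (-1) * w x)"
        using ll[OF H10_pair_test_fun[OF g(1)] pw, of 1 n "-1"] by simp
      then show "norm (l (g n) - l w) \<le> norm (L2norm M (\<lambda>x. grad (g n) x - ?J x)) * c"
        using lb[OF H10_pair_lin[OF H10_pair_test_fun[OF g(1)] pw, of 1 n "-1"]]
        by (simp add: L2norm_nonneg mult.commute)
    qed
    then have 2: "(\<lambda>n. l (g n)) \<longlonglongrightarrow> l w" by (rule LIM_zero_cancel)
    have "(LINT x|M. wgrad \<Omega> \<phi> x \<bullet> ?J x) = (LINT x|M. G x \<bullet> ?J x)"
    proof (rule integral_cong_AE)
      show "AE x in M. wgrad \<Omega> \<phi> x \<bullet> ?J x = G x \<bullet> ?J x"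
        using pair_imp_H10(2)[OF \<phi>(1)] by eventually_elim simp
    qed (intro borel_measurable_integrable L2_inner_integrable LG LJ)+
    with LIMSEQ_unique[OF 1 2] show ?thesis by simp
  qed
  then have "H10 \<Omega> \<phi> \<and> (\<forall>w. H10 \<Omega> w \<longrightarrow> (LINT x|M. wgrad \<Omega> \<phi> x \<bullet> wgrad \<Omega> w x) = (LINT x|M. K x * (u x)\<^sup>2 * w x))"
    using pair_imp_H10(1)[OF \<phi>(1)] by (simp add: l_def)
  from someI[of "\<lambda>\<phi>. H10 \<Omega> \<phi> \<and> (\<forall>w. H10 \<Omega> w \<longrightarrow> (LINT x|M. wgrad \<Omega> \<phi> x \<bullet> wgrad \<Omega> w x) = (LINT x|M. K x * (u x)\<^sup>2 * w x))", OF this]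
  show ?thesis unfolding phi_of_def by blast
qed

section \<open>Critical points and weak solutions\<close>

lemma Espace_diff:
  assumes "u \<in> Espace \<Omega> p" "v \<in> Espace \<Omega> p" "p > 0"
  shows "(\<lambda>x. u x - v x) \<in> Espace \<Omega> p"
    "AE x in M. wgrad \<Omega> (\<lambda>x. u x - v x) x = wgrad \<Omega> u x - wgrad \<Omega> v x"
proof -
  have "H10_pair u (wgrad \<Omega> u)" "H10_pair v (wgrad \<Omega> v)"
    using assms by (auto simp: Espace_def intro: H10_imp_pair)
  from H10_pair_lin[OF this, of 1 "-1"]
  have p: "H10_pair (\<lambda>x. u x - v x) (\<lambda>x. wgrad \<Omega> u x - wgrad \<Omega> v x)" by simp
  show "AE x in M. wgrad \<Omega> (\<lambda>x. u x - v x) x = wgrad \<Omega> u x - wgrad \<Omega> v x"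
    by (rule pair_imp_H10(2)[OF p])
  have [measurable]: "u \<in> borel_measurable M" "v \<in> borel_measurable M"
    and i: "integrable M (\<lambda>x. \<bar>u x\<bar> powr (p+1))" "integrable M (\<lambda>x. \<bar>v x\<bar> powr (p+1))"
    using assms by (auto simp: Espace_def Lp_def)
  have b: "\<bar>a - b\<bar> powr (p+1) \<le> 2 powr (p+1) * (\<bar>a\<bar> powr (p+1) + \<bar>b\<bar> powr (p+1))" for a b :: real
  proof -
    \<comment> \<open>The difference is at most \<open>2 * k\<close>, and \<open>k\<close> is one of
      the two absolute values, so its power is below the sum of both powers.\<close>
    define k where "k = max \<bar>a\<bar> \<bar>b\<bar>"
    have "\<bar>a - b\<bar> powr (p+1) \<le> (2 * k) powr (p+1)"
      using assms(3) by (intro powr_mono2) (auto simp: k_def)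
    also have "\<dots> = 2 powr (p+1) * k powr (p+1)" by (rule powr_mult)
    also have "k powr (p+1) \<le> \<bar>a\<bar> powr (p+1) + \<bar>b\<bar> powr (p+1)" by (auto simp: k_def max_def)
    finally show ?thesis by simp
  qed
  have "integrable M (\<lambda>x. \<bar>u x - v x\<bar> powr (p+1))"
  proof (rule Bochner_Integration.integrable_bound)
    show "integrable M (\<lambda>x. 2 powr (p+1) * (\<bar>u x\<bar> powr (p+1) + \<bar>v x\<bar> powr (p+1)))" using i by simp
    show "AE x in M. norm (\<bar>u x - v x\<bar> powr (p+1)) \<le> norm (2 powr (p+1) * (\<bar>u x\<bar> powr (p+1) + \<bar>v x\<bar> powr (p+1)))"
      using b by (simp add: abs_of_nonneg)
  qed measurable
  then show "(\<lambda>x. u x - v x) \<in> Espace \<Omega> p"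
    using pair_imp_H10(1)[OF p] by (simp add: Espace_def Lp_def)
qed

text \<open>A crude Young inequality: replacing every factor by the larger of
  \<open>\<bar>u x\<bar>\<close> and \<open>\<bar>w x\<bar>\<close> bounds the product by the sum of
  their powers \<open>p + 1\<close>.\<close>

lemma Espace_power_integrable:
  assumes "u \<in> Espace \<Omega> p" "w \<in> Espace \<Omega> p" "p > 1"
  shows "integrable M (\<lambda>x. \<bar>u x\<bar> powr (p - 1) * u x * w x)"
proof -
  have [measurable]: "u \<in> borel_measurable M" "w \<in> borel_measurable M"
    and i: "integrable M (\<lambda>x. \<bar>u x\<bar> powr (p+1))" "integrable M (\<lambda>x. \<bar>w x\<bar> powr (p+1))"
    using assms by (auto simp: Espace_def Lp_def)
  have b: "\<bar>a\<bar> powr (p-1) * \<bar>a\<bar> * \<bar>b\<bar> \<le> \<bar>a\<bar> powr (p+1) + \<bar>b\<bar> powr (p+1)" for a b :: real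
  proof -
    define k where "k = max \<bar>a\<bar> \<bar>b\<bar>"
    have k: "k \<ge> 0" by (simp add: k_def le_max_iff_disj)
    have "\<bar>a\<bar> powr (p-1) * \<bar>a\<bar> * \<bar>b\<bar> \<le> k powr (p-1) * k * k"
      using assms(3) k by (intro mult_mono powr_mono2) (auto simp: k_def)
    also have "\<dots> = k powr ((p-1) + 2)" using k by (simp only: powr_add) (simp add: power2_eq_square)
    also have "\<dots> = k powr (p+1)" by (simp add: add.commute)
    also have "\<dots> \<le> \<bar>a\<bar> powr (p+1) + \<bar>b\<bar> powr (p+1)" by (auto simp: k_def max_def)
    finally show ?thesis .
  qed
  show ?thesis
  proof (rule Bochner_Integration.integrable_bound)
    show "integrable M (\<lambda>x. \<bar>u x\<bar> powr (p+1) + \<bar>w x\<bar> powr (p+1))" using i by simp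
    show "AE x in M. norm (\<bar>u x\<bar> powr (p - 1) * u x * w x) \<le> norm (\<bar>u x\<bar> powr (p+1) + \<bar>w x\<bar> powr (p+1))"
      using b by (simp add: abs_mult)
  qed measurable
qed

text \<open>\<open>phi_of\<close>, \<open>u\<close> and \<open>w\<close> all lie in
  \<open>H10\<close>, so the trilinear estimate covers their product; \<open>K\<close> and
  \<open>h\<close> enter as bounded multipliers.\<close>

lemma Espace_integrable:
  assumes "u \<in> Espace \<Omega> p" "w \<in> Espace \<Omega> p" "Linf \<Omega> K" "Linf \<Omega> h"
  shows "integrable M (\<lambda>x. K x * phi_of \<Omega> K u x * u x * w x)" "integrable M (\<lambda>x. h x * w x)"
proof -
  have H: "H10 \<Omega> u" "H10 \<Omega> w" "H10 \<Omega> (phi_of \<Omega> K u)"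
    using assms phi_of_H10 by (auto simp: Espace_def)
  have "integrable M (\<lambda>x. phi_of \<Omega> K u x * u x * w x)"
    by (rule H10_pair_trilinear) (use H[THEN H10_imp_pair] in blast)
  then have "integrable M (\<lambda>x. K x * (phi_of \<Omega> K u x * u x * w x))"
    by - (rule Linf_mult[OF assms(3)], blast)
  then show "integrable M (\<lambda>x. K x * phi_of \<Omega> K u x * u x * w x)" by (simp add: mult.assoc)
  have "integrable M w" using H10_imp_pair[OF H(2)] by (auto simp: H10_pair_def intro: L2_integrable)
  then show "integrable M (\<lambda>x. h x * w x)" by - (rule Linf_mult[OF assms(4)], blast)
qed

lemma DPhi_eq:
  assumes "u \<in> Espace \<Omega> p" "w \<in> Espace \<Omega> p" "Linf \<Omega> K" "Linf \<Omega> h" "p > 1"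
  shows "DPhi \<Omega> p K h u w = - (LINT x|M. K x * phi_of \<Omega> K u x * u x * w x)
             + (LINT x|M. \<bar>u x\<bar> powr (p - 1) * u x * w x) + (LINT x|M. h x * w x)"
proof -
  have "(- K x * phi_of \<Omega> K u x * u x + \<bar>u x\<bar> powr (p - 1) * u x + h x) * w x
      = - (K x * phi_of \<Omega> K u x * u x * w x) + \<bar>u x\<bar> powr (p - 1) * u x * w x + h x * w x" for x
    by (simp add: algebra_simps)
  then show ?thesis
    unfolding DPhi_def
    using Espace_integrable[OF assms(1-4)] Espace_power_integrable[OF assms(1,2,5)] by simp
qed

end

theorem theorem3p1:
  fixes \<Omega> :: "R3 set" and p :: real and K h :: "R3 \<Rightarrow> real"
    and \<K> :: "(R3 \<Rightarrow> real) set" and u1 :: "R3 \<Rightarrow> real"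
  assumes "smooth_bounded_domain \<Omega>"
    and "p > 1"
    and "Linf \<Omega> K" and "AE x in lebesgue_on \<Omega>. K x \<ge> 0"
    and "Linf \<Omega> h" and "AE x in lebesgue_on \<Omega>. h x > 0"
    and "\<K> \<subseteq> Espace \<Omega> p" and "convex_fun_set \<K>" and "weakly_closed_in_E \<Omega> p \<K>"
    and "critical_point_IK \<Omega> p K h \<K> u1"
    and "\<exists>u2\<in>\<K>. \<forall>w\<in>Espace \<Omega> p.
           (LINT x|lebesgue_on \<Omega>. wgrad \<Omega> u2 x \<bullet> wgrad \<Omega> w x)
           = - (LINT x|lebesgue_on \<Omega>. K x * phi_of \<Omega> K u1 x * u1 x * w x)
             + (LINT x|lebesgue_on \<Omega>. \<bar>u1 x\<bar> powr (p - 1) * u1 x * w x)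
             + (LINT x|lebesgue_on \<Omega>. h x * w x)"
  shows "u1 \<in> \<K> \<and> weak_solution \<Omega> p K h u1"
proof -
  interpret bounded_open_set \<Omega>
    using assms(1) by unfold_locales (auto simp: smooth_bounded_domain_def)
  from assms(11) obtain u2 where u2: "u2 \<in> \<K>"
    and eq: "\<And>w. w \<in> Espace \<Omega> p \<Longrightarrow> (LINT x|M. wgrad \<Omega> u2 x \<bullet> wgrad \<Omega> w x)
           = - (LINT x|M. K x * phi_of \<Omega> K u1 x * u1 x * w x)
             + (LINT x|M. \<bar>u1 x\<bar> powr (p - 1) * u1 x * w x) + (LINT x|M. h x * w x)"
    by blast
  have u1: "u1 \<in> \<K>" using assms(10) by (simp add: critical_point_IK_def)
  have E: "u1 \<in> Espace \<Omega> p" "u2 \<in> Espace \<Omega> p" using u1 u2 assms(7) by auto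
  define p1 where "p1 = wgrad \<Omega> u1"
  define p2 where "p2 = wgrad \<Omega> u2"
  have LE: "L2 M (wgrad \<Omega> w)" if "w \<in> Espace \<Omega> p" for w
    using that H10_imp_pair[of w] by (auto simp: Espace_def H10_pair_def)
  have L: "L2 M p1" "L2 M p2" unfolding p1_def p2_def by (intro LE E)+
  define w where "w = (\<lambda>x. u1 x - u2 x)"
  have w: "w \<in> Espace \<Omega> p" and gw: "AE x in M. wgrad \<Omega> w x = p1 x - p2 x"
    unfolding w_def p1_def p2_def using Espace_diff[OF E] assms(2) by auto
  have "ereal (DPhi \<Omega> p K h u1 w) + psiK \<Omega> \<K> u2 - psiK \<Omega> \<K> u1 \<ge> 0"
    using assms(10) E(2) unfolding critical_point_IK_def w_def by blast
  \<comment> \<open>Both points lie in the convex set, so the extended values are finite and the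
    inequality is one between reals.\<close>
  then have crit: "DPhi \<Omega> p K h u1 w + psi \<Omega> u2 - psi \<Omega> u1 \<ge> 0"
    using u1 u2 by (simp add: psiK_def)
  have "DPhi \<Omega> p K h u1 w = (LINT x|M. p2 x \<bullet> wgrad \<Omega> w x)"
    unfolding DPhi_eq[OF E(1) w assms(3,5,2)] eq[OF w, symmetric] p2_def ..
  also have "\<dots> = (LINT x|M. p1 x \<bullet> p2 x - p2 x \<bullet> p2 x)"
  proof (rule integral_cong_AE)
    show "AE x in M. p2 x \<bullet> wgrad \<Omega> w x = p1 x \<bullet> p2 x - p2 x \<bullet> p2 x"
      using gw by eventually_elim (simp add: inner_diff_right inner_commute)
  qed (intro borel_measurable_integrable Bochner_Integration.integrable_diff L2_inner_integrable L LE w)+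
  also have "\<dots> = (LINT x|M. p1 x \<bullet> p2 x) - (L2norm M p2)\<^sup>2"
    using L by (simp add: L2_inner_integrable L2norm_sq power2_norm_eq_inner)
  \<comment> \<open>Expanding the square shows that \<open>crit\<close> says minus one half of this
    quantity is nonnegative.\<close>
  finally have "(L2norm M (\<lambda>x. p1 x - p2 x))\<^sup>2 \<le> 0"
    using crit L2norm_sq_lin[OF L, of 1 "-1"]
    by (simp add: psi_def p1_def[symmetric] p2_def[symmetric] L2norm_sq[symmetric])
  then have "AE x in M. p1 x - p2 x = 0"
    by (intro L2norm_eq_0_AE L2_diff L) simp
  then have ae: "AE x in M. p1 x = p2 x" by simp
  \<comment> \<open>The left side of the equation for \<open>u2\<close> involves \<open>u2\<close>
    only through its gradient, which may now be exchanged under the integral.\<close>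
  have "(LINT x|M. p1 x \<bullet> wgrad \<Omega> v x) = (LINT x|M. p2 x \<bullet> wgrad \<Omega> v x)" if v: "v \<in> Espace \<Omega> p" for v
  proof (rule integral_cong_AE)
    show "AE x in M. p1 x \<bullet> wgrad \<Omega> v x = p2 x \<bullet> wgrad \<Omega> v x"
      using ae by eventually_elim simp
  qed (intro borel_measurable_integrable L2_inner_integrable L LE v)+
  then have "weak_solution \<Omega> p K h u1"
    unfolding weak_solution_def using E(1) eq by (simp add: p1_def p2_def)
  with u1 show ?thesis by blast
qed

end
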